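(* Let $\mathcal{C}$ be a full-dimensional pointed polyhedral cone in a real vector space $V$ generated by its extreme rays $E=\{R_i\mid 1\le i\le p\}$, and let $V=\bigoplus_{1\le k\le h}V_k$ be its unique decomposition into non-decomposable parts, i.e. every ray of $E$ lies in some $V_k$ and the cone $\mathcal{C}_k\subseteq V_k$ generated by the rays of $E$ lying in $V_k$ is non-decomposable. Suppose the cones $\mathcal{C}_1,\dots,\mathcal{C}_h$ fall into $q$ projective isomorphism types, with type $j$ ($1\le j\le q$) occurring $n_j$ times, and let $\mathcal{C}_{k_j}$ be a representative of type $j$. Then, as permutation groups on the extreme rays, $$\mathrm{Proj}(\mathcal{C})=\prod_{j=1}^q \mathrm{Proj}(\mathcal{C}_{k_j})\wr \mathrm{Sym}(n_j),$$ where $\wr$ denotes the wreath product (acting imprimitively on the rays of the $n_j$ components of type $j$).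
   Context: A polyhedral cone is the set of vectors satisfying finitely many homogeneous linear inequalities; it is assumed full-dimensional in its ambient space and containing no nontrivial linear subspace, hence generated by its extreme rays. A cone with extreme rays $E$ in a vector space $W$ is decomposable if $W=W_1\oplus W_2$ for nonzero subspaces with each ray of $E$ in $W_1$ or $W_2$; otherwise non-decomposable. For a cone $\mathcal{C}$ in $W$ with extreme rays $R_1,\dots,R_p$, $\mathrm{GL}(\mathcal{C})$ is the group of invertible linear maps $A$ of $W$ with $A\mathcal{C}=\mathcal{C}$, and $\mathrm{Proj}(\mathcal{C})$ is the group of permutations $\sigma\in\mathrm{Sym}(p)$ such that some $A\in\mathrm{GL}(\mathcal{C})$ satisfies $AR_i=R_{\sigma(i)}$ for all $i$. Two cones $\mathcal{C}_k\subseteq V_k$, $\mathcal{C}_l\subseteq V_l$ have the same projective isomorphism type if there is a bijective linear map $V_k\to V_l$ mapping $\mathcal{C}_k$ onto $\mathcal{C}_l$. *)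

theory Defs
  imports "HOL-Analysis.Analysis" "HOL-Combinatorics.Permutations"
begin

text \<open>The ambient vector space of every cone is a subspace \<open>W\<close> of an arbitrary real vector space
  \<open>'a\<close>, so that a cone and its components live in one type.  Every linear map defined on a
  subspace extends linearly to \<open>'a\<close>; hence \<open>linear\<close> maps and functionals on \<open>'a\<close> give, by
  restriction, all linear maps and functionals on \<open>W\<close>.\<close>

definition polyhedral_cone :: "'a::real_vector set \<Rightarrow> 'a set \<Rightarrow> bool" where
  "polyhedral_cone W C \<longleftrightarrow>
     (\<exists>F :: ('a \<Rightarrow> real) set. finite F \<and> (\<forall>f\<in>F. linear f) \<and> C = {x\<in>W. \<forall>f\<in>F. 0 \<le> f x})"

definition full_dimensional :: "'a::real_vector set \<Rightarrow> 'a set \<Rightarrow> bool" where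
  "full_dimensional W C \<longleftrightarrow> span C = W"

definition pointed :: "'a::real_vector set \<Rightarrow> bool" where
  "pointed C \<longleftrightarrow> (\<forall>S. subspace S \<and> S \<subseteq> C \<longrightarrow> S = {0})"

definition ray :: "'a::real_vector \<Rightarrow> 'a set" where
  "ray v = {t *\<^sub>R v |t. 0 \<le> t}"

definition extreme_rays :: "'a::real_vector set \<Rightarrow> 'a set set" where
  "extreme_rays C = {r. (\<exists>v. v \<noteq> 0 \<and> r = ray v) \<and> r face_of C}"

text \<open>Internal direct sums: every element of \<open>W\<close> is in exactly one way a sum of elements of the
  summands.\<close>

definition direct_sum2 :: "'a::real_vector set \<Rightarrow> 'a set \<Rightarrow> 'a set \<Rightarrow> bool" where
  "direct_sum2 W W1 W2 \<longleftrightarrow>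
     subspace W1 \<and> subspace W2 \<and> bij_betw (\<lambda>(x, y). x + y) (W1 \<times> W2) W"

definition direct_sum :: "'a::real_vector set \<Rightarrow> 'k set \<Rightarrow> ('k \<Rightarrow> 'a set) \<Rightarrow> bool" where
  "direct_sum W K U \<longleftrightarrow>
     (\<forall>k\<in>K. subspace (U k)) \<and> bij_betw (\<lambda>x. \<Sum>k\<in>K. x k) (PiE K U) W"

definition decomposable :: "'a::real_vector set \<Rightarrow> 'a set \<Rightarrow> bool" where
  "decomposable W C \<longleftrightarrow>
     (\<exists>W1 W2. direct_sum2 W W1 W2 \<and> W1 \<noteq> {0} \<and> W2 \<noteq> {0} \<and>
        (\<forall>r\<in>extreme_rays C. r \<subseteq> W1 \<or> r \<subseteq> W2))"

definition part_cone :: "'a::real_vector set \<Rightarrow> 'a set \<Rightarrow> 'a set" where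
  "part_cone C U = convex_cone hull (\<Union>{r \<in> extreme_rays C. r \<subseteq> U})"

definition nondecomposable_parts ::
    "'a::real_vector set \<Rightarrow> 'a set \<Rightarrow> 'k set \<Rightarrow> ('k \<Rightarrow> 'a set) \<Rightarrow> bool" where
  "nondecomposable_parts V C K U \<longleftrightarrow>
     direct_sum V K U \<and>
     (\<forall>k\<in>K. U k \<noteq> {0}) \<and>
     (\<forall>r\<in>extreme_rays C. \<exists>k\<in>K. r \<subseteq> U k) \<and>
     (\<forall>k\<in>K. \<not> decomposable (U k) (part_cone C (U k)))"

definition cone_iso ::
    "'a::real_vector set \<Rightarrow> 'a set \<Rightarrow> 'a set \<Rightarrow> 'a set \<Rightarrow> ('a \<Rightarrow> 'a) \<Rightarrow> bool" where
  "cone_iso W C W' C' A \<longleftrightarrow> linear A \<and> bij_betw A W W' \<and> A ` C = C'"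

definition same_proj_type ::
    "'a::real_vector set \<Rightarrow> 'a set \<Rightarrow> 'a set \<Rightarrow> 'a set \<Rightarrow> bool" where
  "same_proj_type W C W' C' \<longleftrightarrow> (\<exists>A. cone_iso W C W' C' A)"

definition GL :: "'a::real_vector set \<Rightarrow> 'a set \<Rightarrow> ('a \<Rightarrow> 'a) set" where
  "GL W C = {restrict A W |A. cone_iso W C W C A}"

text \<open>In \<open>Proj W C I R\<close> the family \<open>R\<close> enumerates, without repetition, the extreme rays of \<open>C\<close>
  by the labels in \<open>I\<close>.\<close>

definition Proj ::
    "'a::real_vector set \<Rightarrow> 'a set \<Rightarrow> 'i set \<Rightarrow> ('i \<Rightarrow> 'a set) \<Rightarrow> ('i \<Rightarrow> 'i) set" where
  "Proj W C I R = {\<sigma>. \<sigma> permutes I \<and> (\<exists>A\<in>GL W C. \<forall>i\<in>I. A ` R i = R (\<sigma> i))}"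

text \<open>Permutation groups are sets of functions that are the identity outside the set acted upon.\<close>

definition Sym :: "nat \<Rightarrow> (nat \<Rightarrow> nat) set" where
  "Sym n = {\<tau>. \<tau> permutes {1..n}}"

text \<open>The wreath product of a permutation group \<open>G\<close> on \<open>X\<close> with a permutation group \<open>H\<close> on \<open>Y\<close>,
  in its imprimitive action on \<open>Y \<times> X\<close>, the disjoint union of copies of \<open>X\<close> indexed by \<open>Y\<close>.\<close>

definition wreath_product ::
    "'x set \<Rightarrow> ('x \<Rightarrow> 'x) set \<Rightarrow> 'y set \<Rightarrow> ('y \<Rightarrow> 'y) set \<Rightarrow> ('y \<times> 'x \<Rightarrow> 'y \<times> 'x) set" where
  "wreath_product X G Y H =
     {\<pi>. \<pi> permutes (Y \<times> X) \<and>
        (\<exists>\<tau>\<in>H. \<exists>g. (\<forall>y\<in>Y. g y \<in> G) \<and> (\<forall>y\<in>Y. \<forall>x\<in>X. \<pi> (y, x) = (\<tau> y, g y x)))}"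

text \<open>The direct product of permutation groups \<open>G j\<close> on \<open>X j\<close>, acting on the disjoint union of
  the \<open>X j\<close>.\<close>

definition perm_direct_product ::
    "'j set \<Rightarrow> ('j \<Rightarrow> 'x set) \<Rightarrow> ('j \<Rightarrow> ('x \<Rightarrow> 'x) set) \<Rightarrow> ('j \<times> 'x \<Rightarrow> 'j \<times> 'x) set" where
  "perm_direct_product J X G =
     {\<pi>. \<pi> permutes (Sigma J X) \<and>
        (\<exists>\<rho>. (\<forall>j\<in>J. \<rho> j \<in> G j) \<and> (\<forall>j\<in>J. \<forall>x\<in>X j. \<pi> (j, x) = (j, \<rho> j x)))}"

definition perm_group_iso ::
    "('x \<Rightarrow> 'y) \<Rightarrow> 'x set \<Rightarrow> ('x \<Rightarrow> 'x) set \<Rightarrow> 'y set \<Rightarrow> ('y \<Rightarrow> 'y) set \<Rightarrow> bool" where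
  "perm_group_iso \<beta> X G Y H \<longleftrightarrow>
     bij_betw \<beta> X Y \<and>
     H = {\<sigma>. \<sigma> permutes Y \<and> (\<exists>\<pi>\<in>G. \<forall>x\<in>X. \<sigma> (\<beta> x) = \<beta> (\<pi> x))}"

text \<open>For a part \<open>U\<close> of the decomposition, the extreme rays of the cone generated by the rays
  lying in \<open>U\<close> are exactly these rays, so they are enumerated by \<open>R\<close> on these labels.\<close>

definition ray_labels :: "nat \<Rightarrow> (nat \<Rightarrow> 'a set) \<Rightarrow> 'a set \<Rightarrow> nat set" where
  "ray_labels p R U = {i\<in>{1..p}. R i \<subseteq> U}"

text \<open>The parts fall into \<open>q\<close> projective isomorphism types: \<open>ty k\<close> is the type of part \<open>k\<close>,
  type \<open>j\<close> occurs \<open>n j\<close> times, and part \<open>rep j\<close> represents it.\<close>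

definition proj_types ::
    "'a::real_vector set \<Rightarrow> nat \<Rightarrow> (nat \<Rightarrow> 'a set) \<Rightarrow> nat \<Rightarrow> (nat \<Rightarrow> nat) \<Rightarrow> (nat \<Rightarrow> nat) \<Rightarrow>
     (nat \<Rightarrow> nat) \<Rightarrow> bool" where
  "proj_types C h U q ty n rep \<longleftrightarrow>
     ty ` {1..h} = {1..q} \<and>
     (\<forall>k\<in>{1..h}. \<forall>l\<in>{1..h}.
        ty k = ty l \<longleftrightarrow> same_proj_type (U k) (part_cone C (U k)) (U l) (part_cone C (U l))) \<and>
     (\<forall>j\<in>{1..q}. n j = card {k\<in>{1..h}. ty k = j}) \<and>
     (\<forall>j\<in>{1..q}. rep j \<in> {1..h} \<and> ty (rep j) = j)"

text \<open>The wreath products act on copies of the rays of the representatives.  These copies are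
  identified with the rays of \<open>C\<close> by numbering the parts of type \<open>j\<close> as
  \<open>\<kappa> j 1, \<dots>, \<kappa> j (n j)\<close> and choosing isomorphisms \<open>\<phi> j m\<close> from the representative of
  type \<open>j\<close> onto part \<open>\<kappa> j m\<close>.\<close>

definition identification ::
    "'a::real_vector set \<Rightarrow> nat \<Rightarrow> (nat \<Rightarrow> 'a set) \<Rightarrow> nat \<Rightarrow> (nat \<Rightarrow> nat) \<Rightarrow> (nat \<Rightarrow> nat) \<Rightarrow>
     (nat \<Rightarrow> nat) \<Rightarrow> (nat \<Rightarrow> nat \<Rightarrow> nat) \<Rightarrow> (nat \<Rightarrow> nat \<Rightarrow> 'a \<Rightarrow> 'a) \<Rightarrow> bool" where
  "identification C h U q ty n rep \<kappa> \<phi> \<longleftrightarrow>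
     (\<forall>j\<in>{1..q}. bij_betw (\<kappa> j) {1..n j} {k\<in>{1..h}. ty k = j} \<and>
        (\<forall>m\<in>{1..n j}. cone_iso (U (rep j)) (part_cone C (U (rep j)))
            (U (\<kappa> j m)) (part_cone C (U (\<kappa> j m))) (\<phi> j m)))"

end

theory Submission
  imports Defs
begin

text \<open>
  A pointed polyhedral cone is generated by its extreme rays, so an automorphism of \<open>C\<close> is the same
  as an automorphism of \<open>V\<close> permuting the extreme rays.  Such an automorphism \<open>A\<close> permutes the
  parts: for a part \<open>U k\<close> and a part \<open>U l\<close> containing the image of some ray of \<open>U k\<close>, the vectors of
  \<open>U k\<close> sent into \<open>U l\<close> and those sent into the sum of the other parts form a decomposition of
  \<open>U k\<close> respecting the rays, so non-decomposability forces \<open>A (U k) \<subseteq> U l\<close>, and the same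
  argument for the inverse of \<open>A\<close> gives equality.  Hence \<open>A\<close> permutes the parts of each projective
  type and, after identifying these with the representative, acts between them by automorphisms of
  the representative: an element of the wreath product.  Conversely, isomorphisms between the parts
  that permute them glue to an automorphism of \<open>C\<close>.
\<close>

subsection \<open>Linear maps and direct sums\<close>

text \<open>Coordinate maps are at first linear only on \<open>V\<close>; total
  \<open>linear\<close> maps are needed to assemble isomorphisms. The values on a basis of
  \<open>V\<close> are extended, and the vectors of \<open>V\<close> at which extension and
  \<open>f\<close> agree form a subspace containing that basis.\<close>

lemma linear_extension_from_subspace:
  fixes f :: "'a::real_vector \<Rightarrow> 'b::real_vector"
  assumes "subspace V"
    and add: "\<And>x y. x \<in> V \<Longrightarrow> y \<in> V \<Longrightarrow> f (x + y) = f x + f y"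
    and scale: "\<And>c x. x \<in> V \<Longrightarrow> f (c *\<^sub>R x) = c *\<^sub>R f x"
  shows "\<exists>g. linear g \<and> (\<forall>x\<in>V. g x = f x)"
proof -
  obtain B where B: "B \<subseteq> V" "independent B" "V \<subseteq> span B"
    using maximal_independent_subset by blast
  obtain g where g: "linear g" "\<forall>x\<in>B. g x = f x"
    using linear_independent_extend[OF B(2), of f] by blast
  have f0: "f 0 = 0"
    using scale[of 0 0] subspace_0[OF assms(1)] by simp
  have "subspace {x \<in> V. g x = f x}"
    using assms(1) g(1) f0 unfolding subspace_def
    by (auto simp: add scale linear_0 linear_add linear_scale)
  then have "span B \<subseteq> {x \<in> V. g x = f x}"
    using B(1) g(2) by (intro span_minimal) auto
  then show ?thesis
    using g(1) B(3) by blast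
qed

text \<open>\<open>PiE\<close> contains only functions that are \<open>undefined\<close> off
  \<open>K\<close>, so the injectivity built into \<open>direct_sum\<close> applies to arbitrary
  families after restricting them to \<open>K\<close>.\<close>

lemma direct_sum_unique:
  assumes "direct_sum W K U" "\<And>k. k \<in> K \<Longrightarrow> x k \<in> U k" "\<And>k. k \<in> K \<Longrightarrow> y k \<in> U k"
    and "(\<Sum>k\<in>K. x k) = (\<Sum>k\<in>K. y k)" "k \<in> K"
  shows "x k = y k"
proof -
  have "inj_on (\<lambda>x. \<Sum>k\<in>K. x k) (PiE K U)"
    using assms(1) by (auto simp: direct_sum_def bij_betw_def)
  moreover have "restrict x K \<in> PiE K U" "restrict y K \<in> PiE K U"
    using assms(2,3) by auto
  moreover have "(\<Sum>k\<in>K. restrict x K k) = (\<Sum>k\<in>K. restrict y K k)"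
    using assms(4) by simp
  ultimately have "restrict x K = restrict y K"
    by (meson inj_onD)
  then show ?thesis
    using assms(5) by (metis restrict_apply)
qed

text \<open>A choice of components is linear on \<open>V\<close> because components are unique:
  componentwise sums and multiples are again valid decompositions. Each component map is then
  extended beyond \<open>V\<close>, where its values carry no meaning.\<close>

lemma direct_sum_projections:
  fixes V :: "'a::real_vector set"
  assumes ds: "direct_sum V K U" and V: "subspace V" and K: "finite K"
  shows "\<exists>P. (\<forall>k\<in>K. linear (P k)) \<and> (\<forall>k\<in>K. \<forall>x\<in>V. P k x \<in> U k) \<and>
    (\<forall>x\<in>V. (\<Sum>k\<in>K. P k x) = x) \<and>
    (\<forall>k\<in>K. \<forall>l\<in>K. \<forall>u\<in>U l. P k u = (if k = l then u else 0)) \<and> (\<forall>k\<in>K. U k \<subseteq> V)"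
proof -
  have sub: "subspace (U k)" if "k \<in> K" for k
    using ds that by (auto simp: direct_sum_def)
  have "\<exists>q. \<forall>x\<in>V. (\<forall>k\<in>K. q x k \<in> U k) \<and> (\<Sum>k\<in>K. q x k) = x"
  proof (intro bchoice ballI)
    fix x assume "x \<in> V"
    then have "x \<in> (\<lambda>x. \<Sum>k\<in>K. x k) ` (PiE K U)"
      using ds by (auto simp: direct_sum_def bij_betw_def)
    then obtain q where "q \<in> PiE K U" "x = (\<Sum>k\<in>K. q k)" by blast
    then show "\<exists>q. (\<forall>k\<in>K. q k \<in> U k) \<and> (\<Sum>k\<in>K. q k) = x"
      by (intro exI[of _ q]) auto
  qed
  then obtain q where q: "\<And>x k. x \<in> V \<Longrightarrow> k \<in> K \<Longrightarrow> q x k \<in> U k"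
    "\<And>x. x \<in> V \<Longrightarrow> (\<Sum>k\<in>K. q x k) = x" by blast
  have add: "q (x + y) k = q x k + q y k" if "x \<in> V" "y \<in> V" "k \<in> K" for x y k
  proof (rule direct_sum_unique[OF ds _ _ _ that(3)])
    have "x + y \<in> V" using V that by (simp add: subspace_add)
    then show "q (x + y) k \<in> U k" if "k \<in> K" for k
      using q(1) that by blast
    show "q x k + q y k \<in> U k" if "k \<in> K" for k
      using q(1) sub that \<open>x \<in> V\<close> \<open>y \<in> V\<close> by (simp add: subspace_add)
    show "(\<Sum>k\<in>K. q (x + y) k) = (\<Sum>k\<in>K. q x k + q y k)"
      using \<open>x + y \<in> V\<close> that by (simp add: q(2) sum.distrib)
  qed
  have scale: "q (c *\<^sub>R x) k = c *\<^sub>R q x k" if "x \<in> V" "k \<in> K" for c x k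
  proof (rule direct_sum_unique[OF ds _ _ _ that(2)])
    have "c *\<^sub>R x \<in> V" using V that by (simp add: subspace_scale)
    then show "q (c *\<^sub>R x) k \<in> U k" if "k \<in> K" for k
      using q(1) that by blast
    show "c *\<^sub>R q x k \<in> U k" if "k \<in> K" for k
      using q(1) sub that \<open>x \<in> V\<close> by (simp add: subspace_scale)
    show "(\<Sum>k\<in>K. q (c *\<^sub>R x) k) = (\<Sum>k\<in>K. c *\<^sub>R q x k)"
      using \<open>c *\<^sub>R x \<in> V\<close> that by (simp add: q(2) scaleR_sum_right[symmetric])
  qed
  have UV: "U k \<subseteq> V" if "k \<in> K" for k
  proof
    fix u assume u: "u \<in> U k"
    \<comment> \<open>The family with \<open>u\<close> in position \<open>k\<close> and
      \<open>0\<close> elsewhere has sum \<open>u\<close>, and sums of such families lie in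
      \<open>V\<close>.\<close>
    let ?x = "\<lambda>l\<in>K. if l = k then u else 0"
    have "?x \<in> PiE K U"
      using u sub by (auto simp: subspace_0)
    then have "(\<Sum>l\<in>K. ?x l) \<in> V"
      using ds bij_betw_apply[of "\<lambda>x. \<Sum>k\<in>K. x k" "PiE K U" V ?x]
      unfolding direct_sum_def by blast
    then show "u \<in> V"
      using that K by (simp add: sum.delta)
  qed
  have proj: "q u k = (if k = l then u else 0)" if "k \<in> K" "l \<in> K" "u \<in> U l" for k l u
  proof -
    have uV: "u \<in> V" using UV that by blast
    have "(\<Sum>k\<in>K. q u k) = (\<Sum>k\<in>K. if k = l then u else 0)"
      using q(2)[OF uV] that K by simp
    then show ?thesis
      using that sub q(1)[OF uV]
      by (intro direct_sum_unique[OF ds, where x = "q u"]) (auto simp: subspace_0)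
  qed
  have "\<exists>P. \<forall>k\<in>K. linear (P k) \<and> (\<forall>x\<in>V. P k x = q x k)"
  proof (intro bchoice ballI)
    fix k assume "k \<in> K"
    then show "\<exists>g. linear g \<and> (\<forall>x\<in>V. g x = q x k)"
      using linear_extension_from_subspace[OF V, of "\<lambda>x. q x k"] add scale by simp
  qed
  then obtain P where P: "\<And>k. k \<in> K \<Longrightarrow> linear (P k)" "\<And>k x. k \<in> K \<Longrightarrow> x \<in> V \<Longrightarrow> P k x = q x k"
    by blast
  have "P k u = (if k = l then u else 0)" if "k \<in> K" "l \<in> K" "u \<in> U l" for k l u
    using P(2)[OF that(1), of u] proj[OF that] UV[OF that(2)] that(3) by auto
  then show ?thesis
    using P q UV by (intro exI[of _ P]) simp
qed

subsection \<open>Extreme rays of polyhedral cones\<close>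

lemma in_ray_iff: "x \<in> ray v \<longleftrightarrow> (\<exists>t\<ge>0. x = t *\<^sub>R v)"
  unfolding ray_def by blast

lemma ray_contains_generator: "v \<in> ray v"
  unfolding in_ray_iff by (rule exI[of _ 1]) simp

lemma ray_scale: "x \<in> ray v \<Longrightarrow> 0 \<le> c \<Longrightarrow> c *\<^sub>R x \<in> ray v"
  unfolding in_ray_iff by (metis mult_nonneg_nonneg scaleR_scaleR)

lemma ray_eqI:
  assumes "x \<in> ray v" "x \<noteq> 0"
  shows "ray x = ray v"
proof -
  obtain c where c: "x = c *\<^sub>R v" "c > 0"
    using assms unfolding in_ray_iff by (auto simp: order_le_less)
  show ?thesis
  proof
    show "ray x \<subseteq> ray v"
      using c ray_scale[OF assms(1)] unfolding ray_def by blast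
    show "ray v \<subseteq> ray x"
    proof
      fix y assume "y \<in> ray v"
      then obtain t where "y = t *\<^sub>R v" "t \<ge> 0" unfolding ray_def by auto
      then have "y = (t / c) *\<^sub>R x \<and> 0 \<le> t / c" using c by simp
      then show "y \<in> ray x" unfolding ray_def by blast
    qed
  qed
qed

lemma convex_ray: "convex (ray v)"
proof -
  have "convex_cone (ray v)"
    unfolding convex_cone_iff
  proof (intro conjI ballI allI impI)
    show "0 \<in> ray v"
      unfolding in_ray_iff by (rule exI[of _ 0]) simp
    show "x + y \<in> ray v" if "x \<in> ray v" "y \<in> ray v" for x y
      using that unfolding in_ray_iff by (metis add_nonneg_nonneg scaleR_add_left)
  qed (rule ray_scale)
  then show ?thesis by (simp add: convex_cone_def)
qed

lemma linear_image_ray: "linear A \<Longrightarrow> A ` ray v = ray (A v)"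
proof -
  assume A: "linear A"
  have "A ` ray v = (\<lambda>t. A (t *\<^sub>R v)) ` {0..}"
    unfolding ray_def by auto
  also have "\<dots> = (\<lambda>t. t *\<^sub>R A v) ` {0..}"
    using A by (simp add: linear_scale)
  also have "\<dots> = ray (A v)"
    unfolding ray_def by auto
  finally show ?thesis .
qed

lemma extreme_raysE:
  assumes "r \<in> extreme_rays C"
  obtains v where "v \<noteq> 0" "r = ray v" "v \<in> r" "r \<subseteq> C" "r face_of C"
  using assms ray_contains_generator unfolding extreme_rays_def face_of_def by blast

text \<open>The midpoint of \<open>x\<close> and \<open>y\<close> lies on the ray, so the face
  property puts both endpoints there. The case \<open>x = y\<close> is separate since the open
  segment is then empty, but there the midpoint is \<open>x\<close> itself.\<close>

lemma extreme_ray_add: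
  assumes r: "r \<in> extreme_rays C" and "x \<in> C" "y \<in> C" "x + y \<in> r"
  shows "x \<in> r" "y \<in> r"
proof -
  obtain v where v: "r = ray v" "r face_of C" using r by (rule extreme_raysE)
  have m: "(1/2) *\<^sub>R (x + y) \<in> r"
    using assms(4) v(1) ray_scale[of _ v "1/2"] by simp
  have "x \<in> r \<and> y \<in> r"
  proof (cases "x = y")
    case True
    then show ?thesis using m by (simp flip: scaleR_2)
  next
    case False
    have "(1/2) *\<^sub>R (x + y) \<in> open_segment x y"
      unfolding in_segment using False
      by (intro conjI exI[of _ "1/2"]) (auto simp: algebra_simps)
    then show ?thesis
      using v(2) m assms(2,3) unfolding face_of_def by blast
  qed
  then show "x \<in> r" "y \<in> r" by auto
qed

text \<open>A vector on an extreme ray splits only into vectors on that ray, so some generator must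
  already lie on it.\<close>

lemma extreme_rays_hull_subset:
  assumes S: "\<And>r. r \<in> S \<Longrightarrow> \<exists>v. r = ray v"
  shows "extreme_rays (convex_cone hull \<Union>S) \<subseteq> S"
proof
  let ?D = "convex_cone hull \<Union>S"
  fix r assume r: "r \<in> extreme_rays ?D"
  then obtain v where v: "v \<noteq> 0" "r = ray v" "v \<in> r" "r \<subseteq> ?D" by (rule extreme_raysE)
  \<comment> \<open>The implication is vacuous off \<open>r\<close> and at \<open>0\<close>. This
    makes \<open>?T\<close> closed under sums: a nonzero sum on \<open>r\<close> has both summands
    on \<open>r\<close>, and one of them is nonzero.\<close>
  let ?T = "{x \<in> ?D. x \<in> r \<and> x \<noteq> 0 \<longrightarrow> r \<in> S}"
  have "?D \<subseteq> ?T"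
  proof (rule hull_minimal)
    show "\<Union>S \<subseteq> ?T"
    proof
      fix x assume "x \<in> \<Union>S"
      then obtain s where s: "s \<in> S" "x \<in> s" by blast
      then have "r \<in> S" if "x \<in> r" "x \<noteq> 0"
        using that S v(2) ray_eqI by metis
      then show "x \<in> ?T"
        using s hull_inc[of x "\<Union>S" convex_cone] by blast
    qed
    have "x + y \<in> ?T" if "x \<in> ?T" "y \<in> ?T" for x y
      using that extreme_ray_add[OF r, of x y] by (auto simp: convex_cone_hull_add)
    moreover have "c *\<^sub>R x \<in> ?T" if x: "x \<in> ?T" and c: "0 \<le> c" for x c
    proof -
      have "r \<in> S" if "c *\<^sub>R x \<in> r" "c *\<^sub>R x \<noteq> 0"
      proof -
        have "(1 / c) *\<^sub>R (c *\<^sub>R x) \<in> r"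
          using that(1) c v(2) ray_scale by (metis zero_le_divide_1_iff)
        then show ?thesis using that(2) x by auto
      qed
      then show ?thesis using x c by (auto simp: convex_cone_hull_mul)
    qed
    moreover have "0 \<in> ?T" by (simp add: convex_cone_hull_contains_0)
    ultimately show "convex_cone ?T"
      unfolding convex_cone_iff by blast
  qed
  then show "r \<in> S" using v by blast
qed

section \<open>Generation of pointed polyhedral cones by their extreme rays\<close>

text \<open>Travelling from \<open>x\<close> in direction \<open>y\<close> keeps the inequalities
  tight at \<open>x\<close> tight, while a functional negative at \<open>y\<close> eventually stops
  the motion. At the last point inside the cone a further inequality has become tight.\<close>

lemma cone_exit:
  fixes F :: "('a::real_vector \<Rightarrow> real) set"
  assumes V: "subspace V" and F: "finite F" "\<forall>f\<in>F. linear f"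
    and C: "C = {x\<in>V. \<forall>f\<in>F. 0 \<le> f x}"
    and x: "x \<in> C" and y: "y \<in> V" "\<forall>f\<in>F. f x = 0 \<longrightarrow> f y = 0" and neg: "\<exists>f\<in>F. f y < 0"
  shows "\<exists>t\<ge>0. x + t *\<^sub>R y \<in> C \<and> {f\<in>F. f (x + t *\<^sub>R y) \<noteq> 0} \<subset> {f\<in>F. f x \<noteq> 0}"
proof -
  let ?G = "{f\<in>F. f y < 0}"
  let ?T = "(\<lambda>f. f x / - f y) ` ?G"
  \<comment> \<open>\<open>f x / - f y\<close> is the time at which \<open>f\<close> vanishes along
    the line, so the minimum over the decreasing functionals is the moment of exit.\<close>
  define t where "t = Min ?T"
  have fin: "finite ?T" "?T \<noteq> {}" using F(1) neg by auto
  then have "t \<in> ?T" unfolding t_def by (rule Min_in)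
  then obtain f0 where f0: "f0 \<in> F" "f0 y < 0" "t = f0 x / - f0 y" by blast
  have t_le: "t \<le> f x / - f y" if "f \<in> F" "f y < 0" for f
    unfolding t_def using fin that by (intro Min_le) auto
  have x0: "0 \<le> f x" if "f \<in> F" for f using x C that by auto
  have t0: "0 \<le> t" using f0 x0[OF f0(1)] by (simp add: divide_nonneg_neg)
  have app: "f (x + t *\<^sub>R y) = f x + t * f y" if "f \<in> F" for f
    using F(2) that by (auto simp: linear_add linear_scale)
  have "0 \<le> f (x + t *\<^sub>R y)" if f: "f \<in> F" for f
  proof (cases "f y < 0")
    case True
    then have "t * (- f y) \<le> f x"
      using t_le[OF f True] pos_le_divide_eq[of "- f y" t "f x"] by simp
    then show ?thesis by (simp add: app f)
  next
    case False
    then show ?thesis using app[OF f] t0 x0[OF f] by simp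
  qed
  then have "x + t *\<^sub>R y \<in> C"
    using x y(1) V unfolding C by (auto intro: subspace_add subspace_scale)
  moreover have "f0 (x + t *\<^sub>R y) = 0" using app[OF f0(1)] f0(2,3) by simp
  moreover have "f0 x \<noteq> 0" using y(2) f0 by auto
  moreover have "f (x + t *\<^sub>R y) = 0" if "f \<in> F" "f x = 0" for f
    using app[OF that(1)] y(2) that by simp
  ultimately show ?thesis
    using t0 f0(1) by (intro exI[of _ t]) blast
qed

lemma polyhedral_cone_convex_cone:
  assumes "subspace V" "polyhedral_cone V C"
  shows "convex_cone C"
proof -
  obtain F :: "('a \<Rightarrow> real) set" where F: "\<forall>f\<in>F. linear f" "C = {x\<in>V. \<forall>f\<in>F. 0 \<le> f x}"
    using assms(2) unfolding polyhedral_cone_def by blast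
  then show ?thesis
    using assms(1) unfolding convex_cone_iff subspace_def
    by (auto simp: linear_0 linear_add linear_scale)
qed

text \<open>
  Induction on the number of inequalities strict at \<open>x\<close>.  If \<open>x\<close> does not span an extreme ray, some
  line through \<open>x\<close> preserves all tight inequalities; leaving the cone along it gives \<open>x' \<noteq> 0\<close> with one
  more tight inequality, and leaving it from \<open>x\<close> in the direction \<open>- x'\<close> gives another such point
  \<open>x''\<close>, with \<open>x = x'' + s *\<^sub>R x'\<close>.
\<close>

lemma polyhedral_cone_generated_by_extreme_rays:
  assumes V: "subspace V" and "polyhedral_cone V C" and "pointed C"
  shows "C = convex_cone hull \<Union>(extreme_rays C)"
proof
  obtain F :: "('a \<Rightarrow> real) set" where F: "finite F" "\<forall>f\<in>F. linear f"
    and C: "C = {x\<in>V. \<forall>f\<in>F. 0 \<le> f x}"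
    using assms(2) unfolding polyhedral_cone_def by blast
  have cc: "convex_cone C" using polyhedral_cone_convex_cone assms by blast
  \<comment> \<open>The common zeros in \<open>V\<close> of all functionals form a subspace inside
    \<open>C\<close>, which pointedness reduces to the origin.\<close>
  have zero: "x = 0" if x: "x \<in> V" "\<forall>f\<in>F. f x = 0" for x
  proof -
    have "subspace {x \<in> V. \<forall>f\<in>F. f x = 0}"
      using V F(2) unfolding subspace_def by (auto simp: linear_0 linear_add linear_scale)
    moreover have "{x \<in> V. \<forall>f\<in>F. f x = 0} \<subseteq> C" unfolding C by auto
    ultimately show ?thesis
      using assms(3) x unfolding pointed_def by blast
  qed
  let ?H = "convex_cone hull \<Union>(extreme_rays C)"
  show "?H \<subseteq> C"
    using cc by (intro hull_minimal) (auto elim!: extreme_raysE)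
  have "x \<in> ?H" if "x \<in> C" for x
    using that
  proof (induction "card {f\<in>F. f x \<noteq> 0}" arbitrary: x rule: less_induct)
    case less
    have smaller: "z \<in> ?H" if "z \<in> C" "{f\<in>F. f z \<noteq> 0} \<subset> {f\<in>F. f x \<noteq> 0}" for z
      using that F(1) by (intro less.hyps psubset_card_mono) auto
    have xV: "x \<in> V" using less.prems C by blast
    show ?case
    proof (cases "x = 0")
      case True
      then show ?thesis by (simp add: convex_cone_hull_contains_0)
    next
      case False
      then obtain f1 where f1: "f1 \<in> F" "f1 x > 0"
        using zero[OF xV] less.prems C by (metis (no_types, lifting) mem_Collect_eq order_le_less)
      show ?thesis
      proof (cases "\<forall>y\<in>V. (\<forall>f\<in>F. f x = 0 \<longrightarrow> f y = 0) \<longrightarrow> (\<exists>c. y = c *\<^sub>R x)")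
        case True
        \<comment> \<open>In this case the inequalities tight at \<open>x\<close> determine a vector
          up to a scalar; \<open>f1\<close>, strictly positive at \<open>x\<close>, makes the scalar
          nonnegative.\<close>
        have in_ray: "a \<in> ray x" if a: "a \<in> C" "\<forall>f\<in>F. f x = 0 \<longrightarrow> f a = 0" for a
        proof -
          obtain c where c: "a = c *\<^sub>R x" using True a C by blast
          have "f1 a = c * f1 x" using c F(2) f1(1) by (simp add: linear_scale)
          moreover have "f1 a \<ge> 0" using a(1) C f1(1) by blast
          ultimately have "c \<ge> 0" using f1(2) by (simp add: zero_le_mult_iff)
          then show ?thesis using c unfolding ray_def by blast
        qed
        have "ray x face_of C"
          unfolding face_of_def
        proof (intro conjI ballI impI)
          show "ray x \<subseteq> C" using cc less.prems unfolding ray_def by (auto intro: convex_cone_scaleR)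
          show "convex (ray x)" by (rule convex_ray)
          fix a b z assume a: "a \<in> C" and b: "b \<in> C" and z: "z \<in> ray x" "z \<in> open_segment a b"
          obtain u where u: "0 < u" "u < 1" "z = (1 - u) *\<^sub>R a + u *\<^sub>R b"
            using z(2) unfolding in_segment by blast
          obtain s where s: "z = s *\<^sub>R x" using z(1) unfolding ray_def by blast
          \<comment> \<open>\<open>f\<close> is nonnegative at both endpoints and a combination of
            the two values with positive weights vanishes, so both are zero. Inequalities tight at
            \<open>x\<close> are thus tight at \<open>a\<close> and \<open>b\<close>.\<close>
          have ab: "f a = 0 \<and> f b = 0" if f: "f \<in> F" "f x = 0" for f
          proof -
            have lf: "linear f" using F(2) f by blast
            have "f z = 0" using s lf f by (simp add: linear_scale)
            moreover have "f z = (1 - u) * f a + u * f b"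
              using u(3) lf by (simp add: linear_add linear_scale)
            moreover have "0 \<le> f a" "0 \<le> f b" using a b C f by auto
            ultimately show ?thesis
              using u(1,2) by (smt (verit) mult_eq_0_iff mult_nonneg_nonneg)
          qed
          show "a \<in> ray x" "b \<in> ray x" using in_ray a b ab by blast+
        qed
        then have "ray x \<in> extreme_rays C"
          using False unfolding extreme_rays_def by blast
        then show ?thesis
          using ray_contains_generator by (intro hull_inc) blast
      next
        case nc: False
        then obtain y0 where y0: "y0 \<in> V" "\<forall>f\<in>F. f x = 0 \<longrightarrow> f y0 = 0" "\<And>c. y0 \<noteq> c *\<^sub>R x"
          by blast
        have "y0 \<noteq> 0" using y0(3)[of 0] by simp
        then obtain f2 where f2: "f2 \<in> F" "f2 y0 \<noteq> 0" using zero y0(1) by blast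
        define y where "y = (if f2 y0 < 0 then y0 else - y0)"
        have y: "y \<in> V" "\<forall>f\<in>F. f x = 0 \<longrightarrow> f y = 0" "f2 y < 0"
          using y0 f2 F(2) V unfolding y_def by (auto simp: linear_neg subspace_neg)
        have y_ne: "y \<noteq> c *\<^sub>R x" for c
          using y0(3)[of c] y0(3)[of "- c"] unfolding y_def
          by (metis minus_equation_iff scaleR_minus_left)
        obtain t where t: "0 \<le> t" "x + t *\<^sub>R y \<in> C"
            "{f\<in>F. f (x + t *\<^sub>R y) \<noteq> 0} \<subset> {f\<in>F. f x \<noteq> 0}"
          using cone_exit[OF V F C less.prems y(1,2)] y(3) f2(1) by blast
        define x' where "x' = x + t *\<^sub>R y"
        have x': "x' \<in> C" "{f\<in>F. f x' \<noteq> 0} \<subset> {f\<in>F. f x \<noteq> 0}"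
          using t x'_def by auto
        \<comment> \<open>The exit point is not the apex, as otherwise \<open>y\<close> would be a
          multiple of \<open>x\<close>. Some functional is therefore positive at \<open>x'\<close>,
          which makes \<open>- x'\<close> a second direction of exit.\<close>
        have "x' \<noteq> 0"
        proof
          assume *: "x' = 0"
          then have t0: "t \<noteq> 0" using False x'_def by auto
          have "- x = t *\<^sub>R y"
            using * x'_def by (simp add: minus_unique)
          then have "(- 1 / t) *\<^sub>R x = (1 / t) *\<^sub>R (t *\<^sub>R y)"
            by (metis scaleR_minus_right scaleR_minus_left minus_divide_left)
          then have "y = (- 1 / t) *\<^sub>R x" using t0 by simp
          then show False using y_ne by blast
        qed
        then obtain f3 where f3: "f3 \<in> F" "f3 x' > 0"
          using zero x'(1) C by (metis (no_types, lifting) mem_Collect_eq order_le_less)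
        have "- x' \<in> V" "\<forall>f\<in>F. f x = 0 \<longrightarrow> f (- x') = 0" "\<exists>f\<in>F. f (- x') < 0"
          using x' C V F(2) f3 by (auto simp: linear_neg subspace_neg)
        then obtain s where s: "0 \<le> s" "x + s *\<^sub>R (- x') \<in> C"
            "{f\<in>F. f (x + s *\<^sub>R (- x')) \<noteq> 0} \<subset> {f\<in>F. f x \<noteq> 0}"
          using cone_exit[OF V F C less.prems, of "- x'"] by blast
        have "x = (x + s *\<^sub>R (- x')) + s *\<^sub>R x'" by simp
        then show ?thesis
          using smaller[OF s(2,3)] smaller[OF x'] s(1)
          by (metis convex_cone_hull_add convex_cone_hull_mul)
      qed
    qed
  qed
  then show "C \<subseteq> ?H" by blast
qed

subsection \<open>Cone isomorphisms\<close>

text \<open>The inverse is a total linear left inverse of \<open>A\<close> on \<open>W\<close>; the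
  cancellation laws are accordingly stated on \<open>W\<close> and \<open>W'\<close>.\<close>

lemma cone_iso_inverse:
  assumes A: "cone_iso W C W' C' A" and W: "subspace W" and "C \<subseteq> W"
  shows "\<exists>B. cone_iso W' C' W C B \<and> (\<forall>x\<in>W. B (A x) = x) \<and> (\<forall>y\<in>W'. A (B y) = y)"
proof -
  have A': "linear A" "inj_on A W" "A ` W = W'" "A ` C = C'"
    using A by (auto simp: cone_iso_def bij_betw_def)
  obtain B where B: "linear B" "\<forall>v\<in>W. B (A v) = v"
    using linear_exists_left_inverse_on[OF A'(1) W A'(2)] by blast
  have "bij_betw B W' W"
    using B(2) A'(3) by (intro bij_betw_byWitness[where f' = A]) auto
  moreover have "B ` C' = C"
  proof -
    have "B (A x) = x" if "x \<in> C" for x using B(2) assms(3) that by blast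
    then show ?thesis unfolding A'(4)[symmetric] by (simp add: image_image)
  qed
  ultimately have "cone_iso W' C' W C B"
    using B(1) by (simp add: cone_iso_def)
  moreover have "\<forall>y\<in>W'. A (B y) = y"
    using B(2) A'(3) by auto
  ultimately show ?thesis
    using B(2) by blast
qed

lemma cone_iso_trans:
  assumes "cone_iso W C W' C' A" "cone_iso W' C' W'' C'' B"
  shows "cone_iso W C W'' C'' (B \<circ> A)"
  using assms unfolding cone_iso_def
  by (auto intro: bij_betw_trans linear_compose simp: image_comp[symmetric])

text \<open>Faces are transported by pulling a segment in \<open>C'\<close> back to
  \<open>C\<close>. Injectivity of \<open>A\<close> is assumed only on \<open>W\<close>, which
  contains the cone and hence the pulled back convex combination.\<close>

lemma cone_iso_extreme_ray:
  assumes A: "cone_iso W C W' C' A" and W: "subspace W" and CW: "C \<subseteq> W"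
    and r: "r \<in> extreme_rays C"
  shows "A ` r \<in> extreme_rays C'"
proof -
  have A': "linear A" "inj_on A W" "A ` C = C'"
    using A by (auto simp: cone_iso_def bij_betw_def)
  obtain v where v: "v \<noteq> 0" "r = ray v" "v \<in> r" "r \<subseteq> C" "r face_of C"
    using r by (rule extreme_raysE)
  have "A v \<noteq> 0"
    using inj_onD[OF A'(2), of v 0] A'(1) v CW W by (auto simp: linear_0 subspace_0)
  moreover have "A ` r face_of C'"
    unfolding face_of_def
  proof (intro conjI ballI impI)
    show "A ` r \<subseteq> C'" using A'(3) v(4) by blast
    show "convex (A ` r)" using A'(1) v(2) by (simp add: linear_image_ray convex_ray)
    fix a b x assume "a \<in> C'" "b \<in> C'" "x \<in> A ` r" and seg: "x \<in> open_segment a b"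
    then obtain a' b' x' where *: "a = A a'" "b = A b'" "x = A x'" "a' \<in> C" "b' \<in> C" "x' \<in> r"
      using A'(3) by blast
    obtain u where u: "a \<noteq> b" "0 < u" "u < 1" "x = (1 - u) *\<^sub>R a + u *\<^sub>R b"
      using seg unfolding in_segment by blast
    let ?z = "(1 - u) *\<^sub>R a' + u *\<^sub>R b'"
    have "A x' = A ?z" using u(4) * A'(1) by (simp add: linear_add linear_scale)
    moreover have "x' \<in> W" "?z \<in> W"
      using * v(4) CW W by (auto intro!: subspace_add subspace_scale)
    ultimately have "x' = ?z" using inj_onD[OF A'(2)] by blast
    then have "x' \<in> open_segment a' b'"
      using u * unfolding in_segment by auto
    then show "a \<in> A ` r" "b \<in> A ` r"
      using v(5) * unfolding face_of_def by blast+
  qed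
  ultimately show ?thesis
    using v(2) A'(1) unfolding extreme_rays_def by (auto simp: linear_image_ray)
qed

lemma cone_iso_extreme_rays:
  assumes A: "cone_iso W C W' C' A" and W: "subspace W" "subspace W'" and CW: "C \<subseteq> W" "C' \<subseteq> W'"
  shows "bij_betw ((`) A) (extreme_rays C) (extreme_rays C')"
proof -
  obtain B where B: "cone_iso W' C' W C B" "\<And>x. x \<in> W \<Longrightarrow> B (A x) = x"
    "\<And>y. y \<in> W' \<Longrightarrow> A (B y) = y"
    using cone_iso_inverse[OF A W(1) CW(1)] by blast
  have sub: "r \<subseteq> W" if "r \<in> extreme_rays C" for r
    using that CW(1) by (auto elim!: extreme_raysE)
  have sub': "r \<subseteq> W'" if "r \<in> extreme_rays C'" for r
    using that CW(2) by (auto elim!: extreme_raysE)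
  show ?thesis
  proof (rule bij_betw_byWitness[where f' = "(`) B"])
    show "\<forall>r\<in>extreme_rays C. B ` A ` r = r"
    proof
      fix r assume "r \<in> extreme_rays C"
      then have "B (A x) = x" if "x \<in> r" for x using sub B(2) that by blast
      then show "B ` A ` r = r" by (simp add: image_image)
    qed
    show "\<forall>r\<in>extreme_rays C'. A ` B ` r = r"
    proof
      fix r assume "r \<in> extreme_rays C'"
      then have "A (B x) = x" if "x \<in> r" for x using sub' B(3) that by blast
      then show "A ` B ` r = r" by (simp add: image_image)
    qed
    show "(`) A ` extreme_rays C \<subseteq> extreme_rays C'"
      using cone_iso_extreme_ray[OF A W(1) CW(1)] by blast
    show "(`) B ` extreme_rays C' \<subseteq> extreme_rays C"
      using cone_iso_extreme_ray[OF B(1) W(2) CW(2)] by blast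
  qed
qed

subsection \<open>The non-decomposable parts\<close>

text \<open>Polyhedrality and pointedness enter through \<open>gen\<close>. The projections
  \<open>P k\<close> are fixed so that components of vectors can be computed by linear maps.\<close>

locale cone_parts =
  fixes V C :: "'a::real_vector set" and K :: "'k set" and U :: "'k \<Rightarrow> 'a set"
    and P :: "'k \<Rightarrow> 'a \<Rightarrow> 'a"
  assumes V: "subspace V"
    and gen: "C = convex_cone hull \<Union>(extreme_rays C)"
    and span_C: "span C = V"
    and parts: "nondecomposable_parts V C K U"
    and K: "finite K"
    and P_linear: "\<And>k. k \<in> K \<Longrightarrow> linear (P k)"
    and P_in: "\<And>k x. k \<in> K \<Longrightarrow> x \<in> V \<Longrightarrow> P k x \<in> U k"
    and P_sum: "\<And>x. x \<in> V \<Longrightarrow> (\<Sum>k\<in>K. P k x) = x"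
    and P_on: "\<And>k l u. k \<in> K \<Longrightarrow> l \<in> K \<Longrightarrow> u \<in> U l \<Longrightarrow> P k u = (if k = l then u else 0)"
    and U_subset: "\<And>k. k \<in> K \<Longrightarrow> U k \<subseteq> V"
begin

abbreviation D :: "'k \<Rightarrow> 'a set" where "D k \<equiv> part_cone C (U k)"

lemma C_subset: "C \<subseteq> V"
  using span_C span_superset by blast

lemma subspace_U: "k \<in> K \<Longrightarrow> subspace (U k)"
  using parts by (auto simp: nondecomposable_parts_def direct_sum_def)

lemma U_nonzero: "k \<in> K \<Longrightarrow> U k \<noteq> {0}"
  using parts by (auto simp: nondecomposable_parts_def)

lemma nondecomposable: "k \<in> K \<Longrightarrow> \<not> decomposable (U k) (D k)"
  using parts by (auto simp: nondecomposable_parts_def)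

lemma ray_in_part: "r \<in> extreme_rays C \<Longrightarrow> \<exists>k\<in>K. r \<subseteq> U k"
  using parts by (auto simp: nondecomposable_parts_def)

lemma part_unique:
  assumes "k \<in> K" "l \<in> K" "u \<in> U k" "u \<in> U l" "u \<noteq> 0"
  shows "k = l"
  using P_on[of k k u] P_on[of k l u] assms by (auto split: if_splits)

lemma U_inj: "k \<in> K \<Longrightarrow> l \<in> K \<Longrightarrow> U k = U l \<Longrightarrow> k = l"
  using U_nonzero[of k] subspace_0[OF subspace_U[of k]] part_unique[of k l] by blast

lemma ray_part_unique:
  assumes "k \<in> K" "l \<in> K" "r \<in> extreme_rays C" "r \<subseteq> U k" "r \<subseteq> U l"
  shows "k = l"
  using assms part_unique by (meson extreme_raysE subsetD)

lemma span_rays: "span (\<Union>(extreme_rays C)) = V"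
proof
  have "C \<subseteq> span (\<Union>(extreme_rays C))"
    by (subst gen, rule hull_minimal) (rule span_superset convex_cone_span)+
  then show "V \<subseteq> span (\<Union>(extreme_rays C))"
    using span_C span_minimal[OF _ subspace_span] by blast
  have "\<Union>(extreme_rays C) \<subseteq> V"
    using C_subset by (auto elim!: extreme_raysE)
  then show "span (\<Union>(extreme_rays C)) \<subseteq> V"
    using V by (rule span_minimal)
qed

text \<open>\<open>P k\<close> fixes the rays in \<open>U k\<close> and annihilates the others, so
  it maps the spanning set of all rays into the span of those in \<open>U k\<close>; and its image
  of \<open>V\<close> contains \<open>U k\<close>.\<close>

lemma span_part_rays:
  assumes k: "k \<in> K"
  shows "span (\<Union>{r \<in> extreme_rays C. r \<subseteq> U k}) = U k" (is "span ?E = _")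
proof
  show "span ?E \<subseteq> U k"
    using subspace_U[OF k] by (intro span_minimal) auto
  have "P k ` \<Union>(extreme_rays C) \<subseteq> span ?E"
  proof (rule image_subsetI)
    fix x assume "x \<in> \<Union>(extreme_rays C)"
    then obtain r where r: "r \<in> extreme_rays C" "x \<in> r" by blast
    then obtain l where l: "l \<in> K" "r \<subseteq> U l" using ray_in_part by blast
    have Px: "P k x = (if k = l then x else 0)" using P_on k l r by blast
    show "P k x \<in> span ?E"
    proof (cases "k = l")
      case True
      then have "x \<in> ?E" using r l by blast
      then have "x \<in> span ?E" by (rule span_base)
      then show ?thesis using Px True by simp
    next
      case False
      then show ?thesis using Px span_zero by simp
    qed
  qed
  then have "span (P k ` \<Union>(extreme_rays C)) \<subseteq> span ?E"
    using span_minimal[OF _ subspace_span] by blast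
  moreover have "span (P k ` \<Union>(extreme_rays C)) = P k ` V"
    using linear_span_image[OF P_linear[OF k]] span_rays by simp
  moreover have "U k \<subseteq> P k ` V"
  proof
    fix u assume "u \<in> U k"
    then have "u = P k u" "u \<in> V" using P_on[OF k k] U_subset[OF k] by auto
    then show "u \<in> P k ` V" by blast
  qed
  ultimately show "U k \<subseteq> span ?E" by blast
qed

lemma part_cone_subset:
  assumes "k \<in> K"
  shows "D k \<subseteq> U k"
  unfolding part_cone_def
  using subspace_imp_convex_cone[OF subspace_U[OF assms]] by (intro hull_minimal) auto

lemma part_cone_subset_cone: "D k \<subseteq> C"
proof -
  have "D k \<subseteq> convex_cone hull \<Union>(extreme_rays C)"
    unfolding part_cone_def by (intro hull_mono) blast
  then show ?thesis using gen by simp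
qed

text \<open>\<open>extreme_rays_hull_subset\<close> excludes new extreme rays; conversely, a face of
  \<open>C\<close> inside the smaller cone \<open>D k\<close> is a face of
  \<open>D k\<close>.\<close>

lemma extreme_rays_part:
  "extreme_rays (D k) = {r \<in> extreme_rays C. r \<subseteq> U k}" (is "_ = ?E")
proof
  show "extreme_rays (D k) \<subseteq> ?E"
    unfolding part_cone_def
    by (rule extreme_rays_hull_subset) (auto elim!: extreme_raysE)
  show "?E \<subseteq> extreme_rays (D k)"
  proof
    fix r assume r: "r \<in> ?E"
    then obtain v where v: "v \<noteq> 0" "r = ray v" "r face_of C" by (auto elim: extreme_raysE)
    have "r \<subseteq> D k"
      unfolding part_cone_def using r by (meson Union_upper hull_subset order_trans)
    then have "r face_of D k"
      using v(3) part_cone_subset_cone by (metis face_of_subset)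
    then show "r \<in> extreme_rays (D k)"
      using v unfolding extreme_rays_def by blast
  qed
qed

section \<open>Automorphisms of the cone permute the parts\<close>

lemma automorphism_part_subset:
  assumes A: "cone_iso V C V C A" and k: "k \<in> K"
  shows "\<exists>l\<in>K. A ` U k \<subseteq> U l"
proof -
  have A': "linear A" "inj_on A V" "A ` V = V"
    using A by (auto simp: cone_iso_def bij_betw_def)
  have Uk: "subspace (U k)" "U k \<subseteq> V" using subspace_U U_subset k by auto
  have image_part: "\<exists>l\<in>K. A ` r \<subseteq> U l" if "r \<in> extreme_rays C" for r
    using cone_iso_extreme_ray[OF A V C_subset that] ray_in_part by blast
  \<comment> \<open>A part without rays would be the span of the empty set.\<close>
  have "\<exists>r. r \<in> extreme_rays C \<and> r \<subseteq> U k"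
  proof (rule ccontr)
    assume "\<not> ?thesis"
    then have "{r \<in> extreme_rays C. r \<subseteq> U k} = {}" by blast
    then have "U k = span (\<Union>{})" using span_part_rays[OF k] by metis
    then show False using U_nonzero[OF k] by simp
  qed
  then obtain r where r: "r \<in> extreme_rays C" "r \<subseteq> U k" by blast
  then obtain l where l: "l \<in> K" "A ` r \<subseteq> U l" using image_part by blast
  have Pl: "linear (P l)" using P_linear l by blast
  \<comment> \<open>Membership of \<open>A x\<close> in \<open>U l\<close>, or in the sum of the
    other parts, is expressed through \<open>P l\<close>, so both conditions are linear in
    \<open>x\<close>.\<close>
  define W1 where "W1 = {x \<in> U k. P l (A x) = A x}"
  define W2 where "W2 = {x \<in> U k. P l (A x) = 0}"
  have sub: "subspace W1" "subspace W2"
    using Uk(1) A'(1) Pl unfolding subspace_def W1_def W2_def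
    by (auto simp: linear_0 linear_add linear_scale)
  have ker: "x = 0" if "x \<in> U k" "A x = 0" for x
    using inj_onD[OF A'(2), of x 0] that Uk A'(1) V by (auto simp: linear_0 subspace_0)
  have rays: "s \<subseteq> W1 \<or> s \<subseteq> W2" if s: "s \<in> extreme_rays C" "s \<subseteq> U k" for s
  proof -
    obtain l' where l': "l' \<in> K" "A ` s \<subseteq> U l'" using image_part s by blast
    have "P l (A x) = (if l = l' then A x else 0)" if "x \<in> s" for x
      using P_on[OF l(1) l'(1)] l'(2) that by blast
    then show ?thesis
      using s(2) unfolding W1_def W2_def by (cases "l = l'") auto
  qed
  have "U k \<subseteq> {x + y |x y. x \<in> W1 \<and> y \<in> W2}"
  proof -
    have "\<Union>{r \<in> extreme_rays C. r \<subseteq> U k} \<subseteq> {x + y |x y. x \<in> W1 \<and> y \<in> W2}"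
    proof
      fix x assume "x \<in> \<Union>{r \<in> extreme_rays C. r \<subseteq> U k}"
      then have "x \<in> W1 \<or> x \<in> W2" using rays by blast
      then show "x \<in> {x + y |x y. x \<in> W1 \<and> y \<in> W2}"
        using subspace_0[OF sub(1)] subspace_0[OF sub(2)] add_0 add_0_right
        by (metis (mono_tags, lifting) mem_Collect_eq)
    qed
    then show ?thesis
      using span_part_rays[OF k] span_minimal[OF _ subspace_sums[OF sub]] by blast
  qed
  moreover have "x + y \<in> U k" if "x \<in> W1" "y \<in> W2" for x y
    using that Uk(1) unfolding W1_def W2_def by (auto intro: subspace_add)
  ultimately have img: "(\<lambda>(x, y). x + y) ` (W1 \<times> W2) = U k"
    by (auto simp: image_iff)
  have "inj_on (\<lambda>(x, y). x + y) (W1 \<times> W2)"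
  proof (rule inj_onI, clarify)
    fix x y x' y' assume *: "x \<in> W1" "y \<in> W2" "x' \<in> W1" "y' \<in> W2" and eq: "x + y = x' + y'"
    have "x - x' \<in> W1" "y' - y \<in> W2" using * sub by (auto intro: subspace_diff)
    moreover have d: "x - x' = y' - y" using eq by (simp add: algebra_simps)
    \<comment> \<open>The difference lies in both \<open>W1\<close> and \<open>W2\<close>, so
      \<open>P l\<close> sends its image under \<open>A\<close> both to that image and to
      zero.\<close>
    ultimately have "A (x - x') = 0" "x - x' \<in> U k" unfolding W1_def W2_def by auto
    then have "x - x' = 0" using ker by blast
    then show "x = x' \<and> y = y'" using d by simp
  qed
  then have "direct_sum2 (U k) W1 W2"
    unfolding direct_sum2_def bij_betw_def using sub img by blast
  moreover have "W1 \<noteq> {0}"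
  proof -
    obtain v where v: "v \<noteq> 0" "v \<in> r" using r(1) by (rule extreme_raysE)
    have "P l (A v) = A v" using P_on[OF l(1) l(1)] l(2) v(2) by auto
    then have "v \<in> W1" using v r(2) unfolding W1_def by auto
    then show ?thesis using v by blast
  qed
  ultimately have "W2 = {0}"
    using nondecomposable[OF k] rays unfolding decomposable_def extreme_rays_part by blast
  then have "U k \<subseteq> W1"
    using img by auto
  then have "U k = W1"
    unfolding W1_def by blast
  then have "A x \<in> U l" if "x \<in> U k" for x
    using that P_in[OF l(1), of "A x"] A'(3) Uk(2) unfolding W1_def
    by (metis (mono_tags, lifting) imageI mem_Collect_eq subsetD)
  then show ?thesis using l(1) by blast
qed

text \<open>The inverse automorphism sends \<open>U l\<close> back into a single part, which must be
  \<open>U k\<close> because a nonzero vector of \<open>U k\<close> returns to itself. Once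
  \<open>A\<close> maps \<open>U k\<close> onto \<open>U l\<close>, it matches their rays and
  therefore the cones they generate.\<close>

lemma automorphism_part:
  assumes A: "cone_iso V C V C A" and k: "k \<in> K"
  shows "\<exists>l\<in>K. cone_iso (U k) (D k) (U l) (D l) A"
proof -
  have A': "linear A" "inj_on A V" "A ` V = V"
    using A by (auto simp: cone_iso_def bij_betw_def)
  obtain l where l: "l \<in> K" "A ` U k \<subseteq> U l" using automorphism_part_subset[OF A k] by blast
  obtain B where B: "cone_iso V C V C B" "\<And>x. x \<in> V \<Longrightarrow> B (A x) = x" "\<And>x. x \<in> V \<Longrightarrow> A (B x) = x"
    using cone_iso_inverse[OF A V C_subset] by blast
  obtain k' where k': "k' \<in> K" "B ` U l \<subseteq> U k'" using automorphism_part_subset[OF B(1) l(1)] by blast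
  obtain u where u: "u \<in> U k" "u \<noteq> 0"
    using U_nonzero[OF k] subspace_0[OF subspace_U[OF k]] by blast
  have "B (A u) \<in> U k'" using k'(2) l(2) u(1) by blast
  then have "u \<in> U k'" using B(2) u(1) U_subset[OF k] by auto
  then have kk: "k' = k" using part_unique k k'(1) u by blast
  have img: "A ` U k = U l"
  proof
    show "U l \<subseteq> A ` U k"
    proof
      fix y assume y: "y \<in> U l"
      then have "y = A (B y)" using B(3) U_subset[OF l(1)] by auto
      moreover have "B y \<in> U k" using y k'(2) kk by blast
      ultimately show "y \<in> A ` U k" by blast
    qed
  qed (rule l(2))
  have bij: "bij_betw ((`) A) (extreme_rays C) (extreme_rays C)"
    using cone_iso_extreme_rays[OF A V V C_subset C_subset] .
  have "A ` \<Union>{r \<in> extreme_rays C. r \<subseteq> U k} = \<Union>{r \<in> extreme_rays C. r \<subseteq> U l}" (is "A ` \<Union>?Ek = \<Union>?El")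
  proof -
    have "(`) A ` ?Ek = ?El"
    proof
      show "(`) A ` ?Ek \<subseteq> ?El"
        using bij_betwE[OF bij] img by blast
      show "?El \<subseteq> (`) A ` ?Ek"
      proof
        fix s assume s: "s \<in> ?El"
        then obtain r where r: "r \<in> extreme_rays C" "s = A ` r"
          using bij unfolding bij_betw_def by blast
        have "r \<subseteq> U k"
        proof
          fix x assume x: "x \<in> r"
          then have "x \<in> V" using r(1) C_subset by (auto elim!: extreme_raysE)
          moreover have "A x \<in> A ` U k" using x r(2) s img by blast
          ultimately show "x \<in> U k"
            using inj_on_image_mem_iff[OF A'(2)] U_subset[OF k] by blast
        qed
        then show "s \<in> (`) A ` ?Ek" using r by blast
      qed
    qed
    then show ?thesis unfolding image_Union by simp
  qed
  then have "A ` D k = D l"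
    unfolding part_cone_def convex_cone_hull_linear_image[OF A'(1), symmetric] by simp
  moreover have "bij_betw A (U k) (U l)"
    using img inj_on_subset[OF A'(2) U_subset[OF k]] by (simp add: bij_betw_def)
  ultimately have "cone_iso (U k) (D k) (U l) (D l) A"
    using A'(1) by (simp add: cone_iso_def)
  then show ?thesis using l(1) by blast
qed

text \<open>Each component of a vector is moved by its own \<open>B k\<close> and the results are
  added. The resulting map permutes the extreme rays, hence preserves the cone \<open>C\<close> they
  generate and also its span \<open>V\<close>.\<close>

lemma glue_part_isos:
  assumes \<theta>: "bij_betw \<theta> K K"
    and B: "\<And>k. k \<in> K \<Longrightarrow> cone_iso (U k) (D k) (U (\<theta> k)) (D (\<theta> k)) (B k)"
  shows "\<exists>A. cone_iso V C V C A \<and> (\<forall>k\<in>K. \<forall>x\<in>U k. A x = B k x)"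
proof -
  define A where "A x = (\<Sum>k\<in>K. B k (P k x))" for x
  have Bl: "linear (B k)" and Bim: "B k ` U k = U (\<theta> k)" and Binj: "inj_on (B k) (U k)"
    if "k \<in> K" for k
    using B[OF that] by (auto simp: cone_iso_def bij_betw_def)
  have \<theta>K: "\<theta> k \<in> K" if "k \<in> K" for k using bij_betwE[OF \<theta>] that by blast
  have \<theta>_inj: "\<theta> k = \<theta> l \<longleftrightarrow> k = l" if "k \<in> K" "l \<in> K" for k l
    using \<theta> that unfolding bij_betw_def inj_on_def by blast
  have A_linear: "linear A"
  proof -
    have "linear (\<lambda>x. B k (P k x))" if "k \<in> K" for k
      using linear_compose[OF P_linear[OF that] Bl[OF that]] by (simp add: comp_def)
    then have "linear (\<lambda>x. \<Sum>k\<in>K. B k (P k x))"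
      by (intro linear_compose_sum) blast
    then show ?thesis unfolding A_def .
  qed
  have A_on: "A x = B k x" if "k \<in> K" "x \<in> U k" for k x
  proof -
    have "A x = (\<Sum>l\<in>K. if l = k then B k x else 0)"
      unfolding A_def using that P_on Bl by (intro sum.cong) (auto simp: linear_0)
    then show ?thesis using K that(1) by simp
  qed
  have "inj_on A V"
  proof (rule inj_onI)
    fix x y assume x: "x \<in> V" and y: "y \<in> V" and eq: "A x = A y"
    \<comment> \<open>Since \<open>\<theta>\<close> is injective, only the \<open>k\<close>-th
      summand of \<open>A x\<close> contributes to its component in
      \<open>U (\<theta> k)\<close>.\<close>
    have comp: "P (\<theta> k) (A x) = B k (P k x)" if k: "k \<in> K" and x: "x \<in> V" for k x
    proof -
      have "P (\<theta> k) (A x) = (\<Sum>l\<in>K. P (\<theta> k) (B l (P l x)))"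
        unfolding A_def using P_linear[OF \<theta>K[OF k]] by (simp add: linear_sum)
      also have "\<dots> = (\<Sum>l\<in>K. if l = k then B k (P k x) else 0)"
      proof (rule sum.cong[OF refl])
        fix l assume l: "l \<in> K"
        have "B l (P l x) \<in> U (\<theta> l)" using Bim[OF l] P_in[OF l x] by blast
        then show "P (\<theta> k) (B l (P l x)) = (if l = k then B k (P k x) else 0)"
          using P_on[OF \<theta>K[OF k] \<theta>K[OF l]] \<theta>_inj[OF k l] by auto
      qed
      also have "\<dots> = B k (P k x)" using K k by simp
      finally show ?thesis .
    qed
    have "P k x = P k y" if k: "k \<in> K" for k
      using comp[OF k x] comp[OF k y] eq inj_onD[OF Binj[OF k]] P_in[OF k x] P_in[OF k y] by simp
    then have "(\<Sum>k\<in>K. P k x) = (\<Sum>k\<in>K. P k y)" by simp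
    then show "x = y" using P_sum x y by simp
  qed
  moreover have AC: "A ` C = C"
  proof -
    have bijB: "bij_betw ((`) (B k)) (extreme_rays (D k)) (extreme_rays (D (\<theta> k)))" if "k \<in> K" for k
      using cone_iso_extreme_rays[OF B[OF that]] that \<theta>K subspace_U part_cone_subset by blast
    have AB: "A ` r = B k ` r" if "k \<in> K" "r \<subseteq> U k" for k r
      using A_on that by (intro image_cong) auto
    have "(`) A ` extreme_rays C = extreme_rays C"
    proof
      show "(`) A ` extreme_rays C \<subseteq> extreme_rays C"
      proof (rule image_subsetI)
        fix r assume r: "r \<in> extreme_rays C"
        then obtain k where k: "k \<in> K" "r \<subseteq> U k" using ray_in_part by blast
        then have "B k ` r \<in> extreme_rays (D (\<theta> k))"
          using bij_betwE[OF bijB[OF k(1)]] r extreme_rays_part by blast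
        then show "A ` r \<in> extreme_rays C"
          using AB[OF k] extreme_rays_part by auto
      qed
      show "extreme_rays C \<subseteq> (`) A ` extreme_rays C"
      proof
        fix s assume s: "s \<in> extreme_rays C"
        then obtain l where l: "l \<in> K" "s \<subseteq> U l" using ray_in_part by blast
        then obtain k where k: "k \<in> K" "l = \<theta> k" using \<theta> unfolding bij_betw_def by blast
        have "s \<in> extreme_rays (D (\<theta> k))" using s l k extreme_rays_part by blast
        then obtain r where r: "r \<in> extreme_rays (D k)" "s = B k ` r"
          using bijB[OF k(1)] unfolding bij_betw_def by blast
        then have "r \<in> extreme_rays C" "r \<subseteq> U k" using extreme_rays_part by auto
        then show "s \<in> (`) A ` extreme_rays C" using AB[OF k(1)] r(2) by blast
      qed
    qed
    then have "A ` \<Union>(extreme_rays C) = \<Union>(extreme_rays C)" unfolding image_Union by simp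
    then show ?thesis
      using convex_cone_hull_linear_image[OF A_linear, of "\<Union>(extreme_rays C)"] gen by simp
  qed
  moreover have "A ` V = V"
    using linear_span_image[OF A_linear, of C] AC span_C by simp
  ultimately have "cone_iso V C V C A"
    using A_linear by (simp add: cone_iso_def bij_betw_def)
  then show ?thesis using A_on by blast
qed

end

subsection \<open>Permutation groups\<close>

lemma Proj_permutes: "g \<in> Proj W D I R \<Longrightarrow> g permutes I"
  unfolding Proj_def by blast

text \<open>\<open>GL\<close> contains maps cut down to \<open>W\<close> by \<open>restrict\<close>,
  whereas isomorphisms are total. The rays lie in \<open>W\<close>, so both act on them
  alike.\<close>

lemma ProjI:
  assumes "\<sigma> permutes I" "cone_iso W D W D M" "D \<subseteq> W" "R ` I \<subseteq> extreme_rays D"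
    and "\<And>i. i \<in> I \<Longrightarrow> M ` R i = R (\<sigma> i)"
  shows "\<sigma> \<in> Proj W D I R"
proof -
  have "restrict M W ` R i = R (\<sigma> i)" if "i \<in> I" for i
  proof -
    have "R i \<subseteq> W"
      using assms(3,4) that by (metis extreme_raysE image_subset_iff order_trans)
    then have "restrict M W ` R i = M ` R i" by (intro image_cong) auto
    then show ?thesis using assms(5) that by simp
  qed
  moreover have "restrict M W \<in> GL W D" using assms(2) unfolding GL_def by blast
  ultimately show ?thesis using assms(1) unfolding Proj_def by blast
qed

lemma iso_induces_Proj:
  assumes M: "cone_iso W D W D M" and W: "subspace W" and DW: "D \<subseteq> W"
    and R: "bij_betw R I (extreme_rays D)"
  shows "\<exists>g\<in>Proj W D I R. \<forall>i\<in>I. R (g i) = M ` R i"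
proof -
  have bijM: "bij_betw ((`) M) (extreme_rays D) (extreme_rays D)"
    using cone_iso_extreme_rays[OF M W W DW DW] .
  \<comment> \<open>The ray bijection read through the labels, extended by the identity outside
    \<open>I\<close> as \<open>permutes\<close> demands.\<close>
  define g where "g i = (if i \<in> I then inv_into I R (M ` R i) else i)" for i
  have "bij_betw (inv_into I R \<circ> (`) M \<circ> R) I I"
    using bij_betw_trans[OF bij_betw_trans[OF R bijM] bij_betw_inv_into[OF R]] by (simp add: comp_assoc)
  then have "bij_betw g I I"
    by (rule bij_betw_cong[THEN iffD1, rotated]) (simp add: g_def)
  then have g: "g permutes I"
    by (rule bij_imp_permutes) (simp add: g_def)
  have Rg: "R (g i) = M ` R i" if "i \<in> I" for i
  proof -
    have "M ` R i \<in> R ` I"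
      using bij_betw_apply[OF bijM bij_betw_apply[OF R that]] bij_betw_imp_surj_on[OF R] by simp
    then show ?thesis using that by (simp add: g_def f_inv_into_f)
  qed
  have "R ` I \<subseteq> extreme_rays D" using bij_betw_imp_surj_on[OF R] by simp
  from ProjI[OF g M DW this] have "g \<in> Proj W D I R" using Rg by simp
  then show ?thesis using Rg by blast
qed

lemma Proj_imp_iso:
  assumes "g \<in> Proj W D I R" "D \<subseteq> W" "R ` I \<subseteq> extreme_rays D"
  shows "\<exists>M. cone_iso W D W D M \<and> (\<forall>i\<in>I. M ` R i = R (g i))"
proof -
  obtain M where M: "cone_iso W D W D M" "\<And>i. i \<in> I \<Longrightarrow> restrict M W ` R i = R (g i)"
    using assms(1) unfolding Proj_def GL_def by blast
  have "M ` R i = R (g i)" if "i \<in> I" for i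
  proof -
    have "R i \<subseteq> W"
      using assms(2,3) that by (metis extreme_raysE image_subset_iff order_trans)
    then have "restrict M W ` R i = M ` R i" by (intro image_cong) auto
    then show ?thesis using M(2) that by simp
  qed
  then show ?thesis using M(1) by blast
qed

text \<open>Both levels of nesting merge into one pointwise description of \<open>\<pi>\<close>. The
  substance is the backward direction, where the permutation of each layer has to be recovered from
  \<open>\<pi>\<close>.\<close>

lemma product_of_wreath_products_iff:
  "\<pi> \<in> perm_direct_product J (\<lambda>j. Y j \<times> X j) (\<lambda>j. wreath_product (X j) (G j) (Y j) (H j)) \<longleftrightarrow>
    \<pi> permutes (SIGMA j:J. Y j \<times> X j) \<and>
    (\<exists>\<tau> g. (\<forall>j\<in>J. \<tau> j \<in> H j) \<and> (\<forall>j\<in>J. \<forall>y\<in>Y j. g j y \<in> G j) \<and>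
      (\<forall>j\<in>J. \<forall>y\<in>Y j. \<forall>x\<in>X j. \<pi> (j, y, x) = (j, \<tau> j y, g j y x)))"
  (is "?L \<longleftrightarrow> ?R")
proof
  assume ?L
  then obtain \<rho> where \<pi>: "\<pi> permutes (SIGMA j:J. Y j \<times> X j)"
    and \<rho>: "\<forall>j\<in>J. \<rho> j \<in> wreath_product (X j) (G j) (Y j) (H j)"
      "\<forall>j\<in>J. \<forall>x\<in>Y j \<times> X j. \<pi> (j, x) = (j, \<rho> j x)"
    unfolding perm_direct_product_def by blast
  have "\<forall>j\<in>J. \<exists>\<tau> g. \<tau> \<in> H j \<and> (\<forall>y\<in>Y j. g y \<in> G j) \<and> (\<forall>y\<in>Y j. \<forall>x\<in>X j. \<rho> j (y, x) = (\<tau> y, g y x))"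
    using \<rho>(1) unfolding wreath_product_def by blast
  then obtain \<tau> g where "\<forall>j\<in>J. \<tau> j \<in> H j \<and> (\<forall>y\<in>Y j. g j y \<in> G j) \<and>
      (\<forall>y\<in>Y j. \<forall>x\<in>X j. \<rho> j (y, x) = (\<tau> j y, g j y x))"
    unfolding bchoice_iff by blast
  then show ?R using \<pi> \<rho>(2) by auto
next
  assume ?R
  then obtain \<tau> g where \<pi>: "\<pi> permutes (SIGMA j:J. Y j \<times> X j)"
    and \<tau>: "\<forall>j\<in>J. \<tau> j \<in> H j" "\<forall>j\<in>J. \<forall>y\<in>Y j. g j y \<in> G j"
    and eq: "\<forall>j\<in>J. \<forall>y\<in>Y j. \<forall>x\<in>X j. \<pi> (j, y, x) = (j, \<tau> j y, g j y x)"
    by blast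
  \<comment> \<open>The action of \<open>\<pi>\<close> on layer \<open>j\<close>, filled up by the
    identity; as \<open>\<pi>\<close> preserves layers, \<open>\<rho> j\<close> inherits injectivity
    and surjectivity.\<close>
  define \<rho> where "\<rho> j z = (if z \<in> Y j \<times> X j then snd (\<pi> (j, z)) else z)" for j z
  have \<rho>_eq: "\<pi> (j, z) = (j, \<rho> j z)" if "j \<in> J" "z \<in> Y j \<times> X j" for j z
    using eq that unfolding \<rho>_def by auto
  have "\<rho> j permutes (Y j \<times> X j)" if j: "j \<in> J" for j
  proof (rule bij_imp_permutes)
    show "\<rho> j z = z" if "z \<notin> Y j \<times> X j" for z using that unfolding \<rho>_def by simp
    have "inj_on (\<rho> j) (Y j \<times> X j)"
      using \<rho>_eq[OF j] permutes_inj[OF \<pi>] by (metis (no_types, lifting) Pair_inject inj_eq inj_onI)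
    moreover have "\<rho> j ` (Y j \<times> X j) = Y j \<times> X j"
    proof
      show "\<rho> j ` (Y j \<times> X j) \<subseteq> Y j \<times> X j"
      proof (rule image_subsetI)
        fix z assume z: "z \<in> Y j \<times> X j"
        then have "\<pi> (j, z) \<in> (SIGMA j:J. Y j \<times> X j)"
          using permutes_in_image[OF \<pi>] j by blast
        then show "\<rho> j z \<in> Y j \<times> X j" using \<rho>_eq[OF j z] by simp
      qed
      show "Y j \<times> X j \<subseteq> \<rho> j ` (Y j \<times> X j)"
      proof
        fix w assume w: "w \<in> Y j \<times> X j"
        then have "(j, w) \<in> \<pi> ` (SIGMA j:J. Y j \<times> X j)"
          using permutes_image[OF \<pi>] j by blast
        then obtain j' z where z: "j' \<in> J" "z \<in> Y j' \<times> X j'" "(j, w) = \<pi> (j', z)" by blast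
        then have "j = j'" "w = \<rho> j' z" using \<rho>_eq[OF z(1,2)] by auto
        then show "w \<in> \<rho> j ` (Y j \<times> X j)" using z(2) by blast
      qed
    qed
    ultimately show "bij_betw (\<rho> j) (Y j \<times> X j) (Y j \<times> X j)" by (simp add: bij_betw_def)
  qed
  moreover have "\<rho> j (y, x) = (\<tau> j y, g j y x)" if "j \<in> J" "y \<in> Y j" "x \<in> X j" for j y x
    using eq that unfolding \<rho>_def by simp
  ultimately have "\<forall>j\<in>J. \<rho> j \<in> wreath_product (X j) (G j) (Y j) (H j)"
    using \<tau> unfolding wreath_product_def by blast
  then show ?L using \<pi> \<rho>_eq unfolding perm_direct_product_def by blast
qed

subsection \<open>Identification with copies of the representatives\<close>

lemma identification_exists:
  assumes "proj_types C h U q ty n rep"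
  shows "\<exists>\<kappa> \<phi>. identification C h U q ty n rep \<kappa> \<phi>"
proof -
  have "\<exists>\<kappa>. \<forall>j\<in>{1..q}. bij_betw (\<kappa> j) {1..n j} {k\<in>{1..h}. ty k = j}"
  proof (intro bchoice ballI)
    fix j assume "j \<in> {1..q}"
    then have "n j = card {k\<in>{1..h}. ty k = j}" using assms unfolding proj_types_def by blast
    then show "\<exists>f. bij_betw f {1..n j} {k\<in>{1..h}. ty k = j}"
      using ex_bij_betw_nat_finite_1[of "{k\<in>{1..h}. ty k = j}"] by simp
  qed
  then obtain \<kappa> where \<kappa>: "\<forall>j\<in>{1..q}. bij_betw (\<kappa> j) {1..n j} {k\<in>{1..h}. ty k = j}" by blast
  have "\<exists>f. cone_iso (U (rep j)) (part_cone C (U (rep j)))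
      (U (\<kappa> j m)) (part_cone C (U (\<kappa> j m))) f" if j: "j \<in> {1..q}" and m: "m \<in> {1..n j}" for j m
  proof -
    have "\<kappa> j m \<in> {1..h}" "ty (\<kappa> j m) = j"
      using bij_betwE[OF bspec[OF \<kappa> j]] m by auto
    moreover have "rep j \<in> {1..h}" "ty (rep j) = j" using assms j unfolding proj_types_def by auto
    moreover have "\<forall>k\<in>{1..h}. \<forall>l\<in>{1..h}.
        ty k = ty l \<longleftrightarrow> same_proj_type (U k) (part_cone C (U k)) (U l) (part_cone C (U l))"
      using assms unfolding proj_types_def by blast
    ultimately show ?thesis unfolding same_proj_type_def by metis
  qed
  then have "\<exists>\<phi>. \<forall>j\<in>{1..q}. \<forall>m\<in>{1..n j}. cone_iso (U (rep j)) (part_cone C (U (rep j)))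
      (U (\<kappa> j m)) (part_cone C (U (\<kappa> j m))) (\<phi> j m)"
    by metis
  then show ?thesis using \<kappa> unfolding identification_def by blast
qed

locale identified_cone_parts = cone_parts V C "{1..h}" U P
  for V C :: "'a::real_vector set" and h :: nat and U :: "nat \<Rightarrow> 'a set" and P +
  fixes R :: "nat \<Rightarrow> 'a set" and p q :: nat and ty n rep :: "nat \<Rightarrow> nat"
    and \<kappa> :: "nat \<Rightarrow> nat \<Rightarrow> nat" and \<phi> :: "nat \<Rightarrow> nat \<Rightarrow> 'a \<Rightarrow> 'a"
  assumes R: "bij_betw R {1..p} (extreme_rays C)"
    and types: "proj_types C h U q ty n rep"
    and ident: "identification C h U q ty n rep \<kappa> \<phi>"
begin

abbreviation X :: "nat \<Rightarrow> nat set" where "X j \<equiv> ray_labels p R (U (rep j))"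
abbreviation S :: "(nat \<times> nat \<times> nat) set" where "S \<equiv> (SIGMA j:{1..q}. {1..n j} \<times> X j)"

lemma R_in: "i \<in> {1..p} \<Longrightarrow> R i \<in> extreme_rays C"
  using bij_betwE[OF R] by blast

lemma R_inj: "i \<in> {1..p} \<Longrightarrow> i' \<in> {1..p} \<Longrightarrow> R i = R i' \<Longrightarrow> i = i'"
  using R unfolding bij_betw_def inj_on_def by blast

lemma R_labels: "bij_betw R (ray_labels p R (U k)) (extreme_rays (D k))"
proof -
  have "R ` ray_labels p R (U k) = extreme_rays (D k)"
    unfolding extreme_rays_part ray_labels_def
    unfolding bij_betw_imp_surj_on[OF R, symmetric] by blast
  moreover have "inj_on R (ray_labels p R (U k))"
    using R_inj unfolding ray_labels_def inj_on_def by blast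
  ultimately show ?thesis by (simp add: bij_betw_def)
qed

lemma rep_in: "j \<in> {1..q} \<Longrightarrow> rep j \<in> {1..h}"
  using types unfolding proj_types_def by blast

lemma \<kappa>_in: "j \<in> {1..q} \<Longrightarrow> m \<in> {1..n j} \<Longrightarrow> \<kappa> j m \<in> {1..h} \<and> ty (\<kappa> j m) = j"
  using ident bij_betwE unfolding identification_def by fastforce

lemma \<kappa>_inj:
  "j \<in> {1..q} \<Longrightarrow> m \<in> {1..n j} \<Longrightarrow> m' \<in> {1..n j} \<Longrightarrow> \<kappa> j m = \<kappa> j m' \<Longrightarrow> m = m'"
  using ident unfolding identification_def bij_betw_def inj_on_def by blast

lemma \<kappa>_surj:
  assumes "k \<in> {1..h}"
  shows "ty k \<in> {1..q} \<and> (\<exists>m\<in>{1..n (ty k)}. k = \<kappa> (ty k) m)"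
proof -
  have j: "ty k \<in> {1..q}" using types assms unfolding proj_types_def by blast
  then have "\<kappa> (ty k) ` {1..n (ty k)} = {l\<in>{1..h}. ty l = ty k}"
    using ident unfolding identification_def bij_betw_def by blast
  then show ?thesis using j assms by blast
qed

lemma \<phi>_iso: "j \<in> {1..q} \<Longrightarrow> m \<in> {1..n j} \<Longrightarrow>
    cone_iso (U (rep j)) (D (rep j)) (U (\<kappa> j m)) (D (\<kappa> j m)) (\<phi> j m)"
  using ident unfolding identification_def by blast

lemma \<phi>_rays: "j \<in> {1..q} \<Longrightarrow> m \<in> {1..n j} \<Longrightarrow>
    bij_betw ((`) (\<phi> j m)) (extreme_rays (D (rep j))) (extreme_rays (D (\<kappa> j m)))"
  using cone_iso_extreme_rays[OF \<phi>_iso] rep_in \<kappa>_in subspace_U part_cone_subset by blast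

section \<open>Labelling the rays of the cone by copies of the rays of the representatives\<close>

definition \<beta> :: "nat \<times> nat \<times> nat \<Rightarrow> nat" where
  "\<beta> = (\<lambda>(j, m, i). inv_into {1..p} R (\<phi> j m ` R i))"

lemma \<phi>_ray:
  assumes "j \<in> {1..q}" "m \<in> {1..n j}" "i \<in> X j"
  shows "\<phi> j m ` R i \<in> extreme_rays (D (\<kappa> j m))"
  using bij_betwE[OF \<phi>_rays[OF assms(1,2)]] bij_betwE[OF R_labels] assms(3) by blast

lemma \<beta>:
  assumes "j \<in> {1..q}" "m \<in> {1..n j}" "i \<in> X j"
  shows "R (\<beta> (j, m, i)) = \<phi> j m ` R i" "\<beta> (j, m, i) \<in> {1..p}"
proof -
  have "\<phi> j m ` R i \<in> R ` {1..p}"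
    using \<phi>_ray[OF assms] extreme_rays_part R unfolding bij_betw_def by auto
  then show "R (\<beta> (j, m, i)) = \<phi> j m ` R i" "\<beta> (j, m, i) \<in> {1..p}"
    unfolding \<beta>_def by (simp_all only: prod.case f_inv_into_f inv_into_into)
qed

text \<open>A ray of \<open>C\<close> determines its part, hence the type and the number of the
  copy; within one copy \<open>\<phi> j m\<close> is injective on rays. For surjectivity, a ray is
  pulled back along \<open>\<phi> j m\<close> from the part containing it.\<close>

lemma bij_\<beta>: "bij_betw \<beta> S {1..p}"
  unfolding bij_betw_def
proof
  show "inj_on \<beta> S"
  proof (rule inj_onI)
    fix y y' assume y: "y \<in> S" "y' \<in> S" "\<beta> y = \<beta> y'"
    obtain j m i where jmi: "y = (j, m, i)" and x: "j \<in> {1..q}" "m \<in> {1..n j}" "i \<in> X j"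
      using y(1) by blast
    obtain j' m' i' where jmi': "y' = (j', m', i')"
      and x': "j' \<in> {1..q}" "m' \<in> {1..n j'}" "i' \<in> X j'"
      using y(2) by blast
    have eq: "\<phi> j m ` R i = \<phi> j' m' ` R i'"
      using y(3) jmi jmi' \<beta>(1)[OF x] \<beta>(1)[OF x'] by simp
    then have "\<kappa> j m = \<kappa> j' m'"
      using \<phi>_ray[OF x] \<phi>_ray[OF x'] \<kappa>_in x x' extreme_rays_part
        ray_part_unique[of "\<kappa> j m" "\<kappa> j' m'" "\<phi> j m ` R i"] by simp
    then have jm: "j = j'" "m = m'" using \<kappa>_in[OF x(1,2)] \<kappa>_in[OF x'(1,2)] \<kappa>_inj x x' by auto
    have "R i \<in> extreme_rays (D (rep j))" "R i' \<in> extreme_rays (D (rep j))"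
      using bij_betw_apply[OF R_labels] x(3) x'(3) jm by auto
    moreover have "\<phi> j m ` R i = \<phi> j m ` R i'" using eq jm by simp
    ultimately have "R i = R i'"
      using bij_betw_imp_inj_on[OF \<phi>_rays[OF x(1,2)]] by (metis inj_onD)
    then have "i = i'" using R_inj x(3) x'(3) unfolding ray_labels_def by blast
    then show "y = y'" using jm jmi jmi' by simp
  qed
  show "\<beta> ` S = {1..p}"
  proof
    show "\<beta> ` S \<subseteq> {1..p}" using \<beta>(2) by auto
    show "{1..p} \<subseteq> \<beta> ` S"
    proof
      fix i' assume i': "i' \<in> {1..p}"
      then obtain k where k: "k \<in> {1..h}" "R i' \<subseteq> U k" using R_in ray_in_part by blast
      define j where "j = ty k"
      obtain m where m: "j \<in> {1..q}" "m \<in> {1..n j}" "k = \<kappa> j m"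
        using \<kappa>_surj[OF k(1)] unfolding j_def by blast
      have "R i' \<in> extreme_rays (D (\<kappa> j m))" using k m R_in[OF i'] extreme_rays_part by blast
      then obtain r where r: "r \<in> extreme_rays (D (rep j))" "R i' = \<phi> j m ` r"
        using \<phi>_rays[OF m(1,2)] unfolding bij_betw_def by blast
      then obtain i where i: "i \<in> X j" "r = R i"
        using bij_betw_imp_surj_on[OF R_labels[of "rep j"]] by blast
      have "R (\<beta> (j, m, i)) = R i'"
        using \<beta>(1)[OF m(1,2) i(1)] r(2) i(2) by simp
      then have "\<beta> (j, m, i) = i'"
        using R_inj \<beta>(2)[OF m(1,2) i(1)] i' by blast
      moreover have "(j, m, i) \<in> S" using m i(1) by simp
      ultimately show "i' \<in> \<beta> ` S" by blast
    qed
  qed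
qed

section \<open>Correspondence of projective symmetries with elements of the wreath products\<close>

text \<open>An automorphism \<open>A\<close> realising \<open>\<sigma>\<close> carries each part
  onto one of the same type, which gives \<open>\<tau>\<close>. Comparing the identifications of
  source and target part gives an automorphism of the representative, which gives
  \<open>g\<close>.\<close>

lemma Proj_imp_product_of_wreath_products:
  assumes \<sigma>: "\<sigma> \<in> Proj V C {1..p} R"
  shows "\<exists>\<pi>\<in>perm_direct_product {1..q} (\<lambda>j. {1..n j} \<times> X j)
    (\<lambda>j. wreath_product (X j) (Proj (U (rep j)) (D (rep j)) (X j) R) {1..n j} (Sym (n j))).
    \<forall>x\<in>S. \<sigma> (\<beta> x) = \<beta> (\<pi> x)"
proof -
  have perm: "\<sigma> permutes {1..p}" using Proj_permutes[OF \<sigma>] .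
  have "R ` {1..p} \<subseteq> extreme_rays C" using R_in by blast
  from Proj_imp_iso[OF \<sigma> C_subset this]
  obtain A where A: "cone_iso V C V C A" "\<And>i. i \<in> {1..p} \<Longrightarrow> A ` R i = R (\<sigma> i)"
    by blast
  have Ainj: "inj_on A V" using A(1) by (auto simp: cone_iso_def bij_betw_def)
  have "\<exists>m'. m' \<in> {1..n j} \<and> cone_iso (U (\<kappa> j m)) (D (\<kappa> j m)) (U (\<kappa> j m')) (D (\<kappa> j m')) A"
    if j: "j \<in> {1..q}" and m: "m \<in> {1..n j}" for j m
  proof -
    obtain l where l: "l \<in> {1..h}" "cone_iso (U (\<kappa> j m)) (D (\<kappa> j m)) (U l) (D l) A"
      using automorphism_part[OF A(1)] \<kappa>_in[OF j m] by blast
    \<comment> \<open>\<open>A\<close> itself witnesses that the two parts have the same projective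
      type.\<close>
    then have "ty l = j"
      using types \<kappa>_in[OF j m] unfolding proj_types_def same_proj_type_def by metis
    then show ?thesis using \<kappa>_surj[OF l(1)] l(2) by metis
  qed
  then obtain t where t: "\<And>j m. j \<in> {1..q} \<Longrightarrow> m \<in> {1..n j} \<Longrightarrow> t j m \<in> {1..n j}"
    "\<And>j m. j \<in> {1..q} \<Longrightarrow> m \<in> {1..n j} \<Longrightarrow>
      cone_iso (U (\<kappa> j m)) (D (\<kappa> j m)) (U (\<kappa> j (t j m))) (D (\<kappa> j (t j m))) A"
    by metis
  \<comment> \<open>The chosen \<open>t\<close> is unconstrained outside \<open>{1..n j}\<close>, so
    it is replaced by the identity there.\<close>
  define \<tau> where "\<tau> j m = (if m \<in> {1..n j} then t j m else m)" for j m
  have \<tau>: "\<tau> j \<in> Sym (n j)" if j: "j \<in> {1..q}" for j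
  proof -
    have "inj_on (\<tau> j) {1..n j}"
    proof (rule inj_onI)
      fix m m' assume m: "m \<in> {1..n j}" and m': "m' \<in> {1..n j}" and "\<tau> j m = \<tau> j m'"
      then have "t j m = t j m'" by (simp add: \<tau>_def)
      then have "A ` U (\<kappa> j m) = A ` U (\<kappa> j m')"
        using t(2)[OF j m] t(2)[OF j m'] by (simp add: cone_iso_def bij_betw_def)
      then have "U (\<kappa> j m) = U (\<kappa> j m')"
        using inj_on_image_eq_iff[OF Ainj] U_subset \<kappa>_in[OF j] m m' by simp
      then show "m = m'" using U_inj \<kappa>_inj[OF j m m'] \<kappa>_in[OF j] m m' by simp
    qed
    then have "\<tau> j permutes {1..n j}"
      using t(1)[OF j] by (intro inj_imp_permutes) (auto simp: \<tau>_def)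
    then show ?thesis by (simp add: Sym_def)
  qed
  have "\<exists>g. g \<in> Proj (U (rep j)) (D (rep j)) (X j) R \<and>
      (\<forall>i\<in>X j. \<phi> j (t j m) ` R (g i) = A ` \<phi> j m ` R i)"
    if j: "j \<in> {1..q}" and m: "m \<in> {1..n j}" for j m
  proof -
    have W: "subspace (U (rep j))" "D (rep j) \<subseteq> U (rep j)"
      using subspace_U part_cone_subset rep_in[OF j] by auto
    \<comment> \<open>\<open>\<psi>\<close> undoes the identification of the target part, so that
      \<open>\<psi> \<circ> (A \<circ> \<phi> j m)\<close> is a self-isomorphism of the
      representative; it induces the permutation \<open>g\<close>.\<close>
    obtain \<psi> where \<psi>: "cone_iso (U (\<kappa> j (t j m))) (D (\<kappa> j (t j m))) (U (rep j)) (D (rep j)) \<psi>"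
      "\<forall>y\<in>U (\<kappa> j (t j m)). \<phi> j (t j m) (\<psi> y) = y"
      using cone_iso_inverse[OF \<phi>_iso[OF j t(1)[OF j m]] W] by blast
    have iso1: "cone_iso (U (rep j)) (D (rep j)) (U (\<kappa> j (t j m))) (D (\<kappa> j (t j m))) (A \<circ> \<phi> j m)"
      using cone_iso_trans[OF \<phi>_iso[OF j m] t(2)[OF j m]] .
    obtain g where g: "g \<in> Proj (U (rep j)) (D (rep j)) (X j) R"
      "\<forall>i\<in>X j. R (g i) = (\<psi> \<circ> (A \<circ> \<phi> j m)) ` R i"
      using iso_induces_Proj[OF cone_iso_trans[OF iso1 \<psi>(1)] W R_labels] by blast
    have "\<phi> j (t j m) ` R (g i) = A ` \<phi> j m ` R i" if i: "i \<in> X j" for i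
    proof -
      have "R i \<subseteq> U (rep j)" using i by (simp add: ray_labels_def)
      then have "A (\<phi> j m x) \<in> U (\<kappa> j (t j m))" if "x \<in> R i" for x
        using iso1 that unfolding cone_iso_def by (metis bij_betw_apply comp_apply subsetD)
      then have "\<phi> j (t j m) (\<psi> (A (\<phi> j m x))) = A (\<phi> j m x)" if "x \<in> R i" for x
        using \<psi>(2) that by blast
      then show ?thesis using bspec[OF g(2) i] by (simp add: image_image)
    qed
    then show ?thesis using g(1) by blast
  qed
  then obtain g where g: "\<And>j m. j \<in> {1..q} \<Longrightarrow> m \<in> {1..n j} \<Longrightarrow> g j m \<in> Proj (U (rep j)) (D (rep j)) (X j) R"
    "\<And>j m i. j \<in> {1..q} \<Longrightarrow> m \<in> {1..n j} \<Longrightarrow> i \<in> X j \<Longrightarrow>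
      \<phi> j (t j m) ` R (g j m i) = A ` \<phi> j m ` R i"
    by metis
  have in_S: "(j, t j m, g j m i) \<in> S" and conj: "\<sigma> (\<beta> (j, m, i)) = \<beta> (j, t j m, g j m i)"
    if j: "j \<in> {1..q}" and m: "m \<in> {1..n j}" and i: "i \<in> X j" for j m i
  proof -
    have gi: "g j m i \<in> X j"
      using permutes_in_image[OF Proj_permutes[OF g(1)[OF j m]]] i by simp
    then show "(j, t j m, g j m i) \<in> S" using j t(1)[OF j m] by blast
    have "R (\<sigma> (\<beta> (j, m, i))) = R (\<beta> (j, t j m, g j m i))"
      using A(2)[OF \<beta>(2)[OF j m i]] \<beta>(1)[OF j m i] \<beta>(1)[OF j t(1)[OF j m] gi] g(2)[OF j m i] by simp
    then show "\<sigma> (\<beta> (j, m, i)) = \<beta> (j, t j m, g j m i)"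
      using R_inj \<beta>(2)[OF j m i] \<beta>(2)[OF j t(1)[OF j m] gi] permutes_in_image[OF perm] by blast
  qed
  \<comment> \<open>This is \<open>\<sigma>\<close> transported along \<open>\<beta>\<close>. In
    this form it is clearly a permutation of \<open>S\<close>; the coordinate formula is derived
    afterwards.\<close>
  define \<pi> where "\<pi> x = (if x \<in> S then inv_into S \<beta> (\<sigma> (\<beta> x)) else x)" for x
  have "bij_betw (inv_into S \<beta> \<circ> (\<sigma> \<circ> \<beta>)) S S"
    using bij_betw_trans[OF bij_betw_trans[OF bij_\<beta> permutes_imp_bij[OF perm]] bij_betw_inv_into[OF bij_\<beta>]] .
  then have "bij_betw \<pi> S S"
    by (rule bij_betw_cong[THEN iffD1, rotated]) (simp add: \<pi>_def)
  then have \<pi>: "\<pi> permutes S"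
    by (rule bij_imp_permutes) (simp add: \<pi>_def)
  have \<pi>_eq: "\<pi> (j, m, i) = (j, \<tau> j m, g j m i)" if "j \<in> {1..q}" "m \<in> {1..n j}" "i \<in> X j" for j m i
  proof -
    have "\<pi> (j, m, i) = inv_into S \<beta> (\<beta> (j, t j m, g j m i))"
      using conj[OF that] that by (simp add: \<pi>_def)
    also have "\<dots> = (j, t j m, g j m i)"
      using bij_betw_inv_into_left[OF bij_\<beta> in_S[OF that]] .
    finally show ?thesis using that by (simp add: \<tau>_def)
  qed
  have "\<sigma> (\<beta> x) = \<beta> (\<pi> x)" if "x \<in> S" for x
  proof -
    obtain j m i where x: "x = (j, m, i)" "j \<in> {1..q}" "m \<in> {1..n j}" "i \<in> X j"
      using \<open>x \<in> S\<close> by blast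
    then show ?thesis using conj[OF x(2-4)] \<pi>_eq[OF x(2-4)] by (simp add: \<tau>_def)
  qed
  moreover have "\<pi> \<in> perm_direct_product {1..q} (\<lambda>j. {1..n j} \<times> X j)
    (\<lambda>j. wreath_product (X j) (Proj (U (rep j)) (D (rep j)) (X j) R) {1..n j} (Sym (n j)))"
    unfolding product_of_wreath_products_iff
    using \<pi> \<tau> g(1) \<pi>_eq by blast
  ultimately show ?thesis by blast
qed

text \<open>\<open>\<tau>\<close> prescribes where each part goes and \<open>g\<close> by which
  automorphism of the representative. These data give isomorphisms between parts, which
  \<open>glue_part_isos\<close> combines into an automorphism of \<open>C\<close>.\<close>

lemma product_of_wreath_products_imp_Proj:
  assumes \<sigma>: "\<sigma> permutes {1..p}"
    and \<pi>: "\<pi> \<in> perm_direct_product {1..q} (\<lambda>j. {1..n j} \<times> X j)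
      (\<lambda>j. wreath_product (X j) (Proj (U (rep j)) (D (rep j)) (X j) R) {1..n j} (Sym (n j)))"
    and conj: "\<And>x. x \<in> S \<Longrightarrow> \<sigma> (\<beta> x) = \<beta> (\<pi> x)"
  shows "\<sigma> \<in> Proj V C {1..p} R"
proof -
  obtain \<tau> g where \<tau>: "\<And>j. j \<in> {1..q} \<Longrightarrow> \<tau> j permutes {1..n j}"
    and g: "\<And>j m. j \<in> {1..q} \<Longrightarrow> m \<in> {1..n j} \<Longrightarrow> g j m \<in> Proj (U (rep j)) (D (rep j)) (X j) R"
    and \<pi>_eq: "\<And>j m i. j \<in> {1..q} \<Longrightarrow> m \<in> {1..n j} \<Longrightarrow> i \<in> X j \<Longrightarrow> \<pi> (j, m, i) = (j, \<tau> j m, g j m i)"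
    using \<pi> unfolding product_of_wreath_products_iff Sym_def by blast
  have \<tau>_in: "\<tau> j m \<in> {1..n j}" if "j \<in> {1..q}" "m \<in> {1..n j}" for j m
    using permutes_in_image[OF \<tau>] that by blast
  have "\<exists>B. cone_iso (U (\<kappa> j m)) (D (\<kappa> j m)) (U (\<kappa> j (\<tau> j m))) (D (\<kappa> j (\<tau> j m))) B \<and>
      (\<forall>i\<in>X j. B ` \<phi> j m ` R i = \<phi> j (\<tau> j m) ` R (g j m i))"
    if j: "j \<in> {1..q}" and m: "m \<in> {1..n j}" for j m
  proof -
    have W: "subspace (U (rep j))" "D (rep j) \<subseteq> U (rep j)"
      using subspace_U part_cone_subset rep_in[OF j] by auto
    have RX: "R ` X j \<subseteq> extreme_rays (D (rep j))"
      using R_labels[of "rep j"] unfolding bij_betw_def by simp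
    obtain M where M: "cone_iso (U (rep j)) (D (rep j)) (U (rep j)) (D (rep j)) M"
      "\<forall>i\<in>X j. M ` R i = R (g j m i)"
      using Proj_imp_iso[OF g[OF j m] W(2) RX] by blast
    obtain \<psi> where \<psi>: "cone_iso (U (\<kappa> j m)) (D (\<kappa> j m)) (U (rep j)) (D (rep j)) \<psi>"
      "\<forall>x\<in>U (rep j). \<psi> (\<phi> j m x) = x"
      using cone_iso_inverse[OF \<phi>_iso[OF j m] W] by blast
    \<comment> \<open>Back to the representative, across by an automorphism inducing
      \<open>g j m\<close>, then out to the copy numbered \<open>\<tau> j m\<close>.\<close>
    let ?B = "\<phi> j (\<tau> j m) \<circ> (M \<circ> \<psi>)"
    have "cone_iso (U (\<kappa> j m)) (D (\<kappa> j m)) (U (\<kappa> j (\<tau> j m))) (D (\<kappa> j (\<tau> j m))) ?B"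
      using cone_iso_trans[OF cone_iso_trans[OF \<psi>(1) M(1)] \<phi>_iso[OF j \<tau>_in[OF j m]]] .
    moreover have "?B ` \<phi> j m ` R i = \<phi> j (\<tau> j m) ` R (g j m i)" if i: "i \<in> X j" for i
    proof -
      have "R i \<subseteq> U (rep j)" using i by (simp add: ray_labels_def)
      then have "\<psi> (\<phi> j m x) = x" if "x \<in> R i" for x using \<psi>(2) that by blast
      then have "?B ` \<phi> j m ` R i = \<phi> j (\<tau> j m) ` M ` R i" by (simp add: image_image)
      then show ?thesis using bspec[OF M(2) i] by simp
    qed
    ultimately show ?thesis by blast
  qed
  then obtain B where B: "\<And>j m. j \<in> {1..q} \<Longrightarrow> m \<in> {1..n j} \<Longrightarrow>
      cone_iso (U (\<kappa> j m)) (D (\<kappa> j m)) (U (\<kappa> j (\<tau> j m))) (D (\<kappa> j (\<tau> j m))) (B j m)"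
    "\<And>j m i. j \<in> {1..q} \<Longrightarrow> m \<in> {1..n j} \<Longrightarrow> i \<in> X j \<Longrightarrow>
      B j m ` \<phi> j m ` R i = \<phi> j (\<tau> j m) ` R (g j m i)"
    by metis
  \<comment> \<open>\<open>\<mu> k\<close> is the number of part \<open>k\<close> among those of its
    type; with it \<open>\<tau>\<close> and \<open>B\<close> are reindexed by parts, as
    \<open>glue_part_isos\<close> requires.\<close>
  define \<mu> where "\<mu> k = inv_into {1..n (ty k)} (\<kappa> (ty k)) k" for k
  have \<mu>: "ty k \<in> {1..q}" "\<mu> k \<in> {1..n (ty k)}" "\<kappa> (ty k) (\<mu> k) = k" if "k \<in> {1..h}" for k
  proof -
    show "ty k \<in> {1..q}" using \<kappa>_surj[OF that] by blast
    have "k \<in> \<kappa> (ty k) ` {1..n (ty k)}" using \<kappa>_surj[OF that] by blast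
    then show "\<mu> k \<in> {1..n (ty k)}" "\<kappa> (ty k) (\<mu> k) = k"
      unfolding \<mu>_def by (rule inv_into_into, rule f_inv_into_f)
  qed
  have \<mu>_\<kappa>: "\<mu> (\<kappa> j m) = m" if "j \<in> {1..q}" "m \<in> {1..n j}" for j m
    using \<mu>[of "\<kappa> j m"] \<kappa>_in[OF that] \<kappa>_inj that by auto
  define \<theta> where "\<theta> k = \<kappa> (ty k) (\<tau> (ty k) (\<mu> k))" for k
  have \<theta>_in: "\<theta> k \<in> {1..h}" "ty (\<theta> k) = ty k" if "k \<in> {1..h}" for k
    using \<kappa>_in[OF \<mu>(1)[OF that] \<tau>_in[OF \<mu>(1,2)[OF that]]] unfolding \<theta>_def by auto
  have "inj_on \<theta> {1..h}"
  proof (rule inj_onI)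
    fix k l assume k: "k \<in> {1..h}" and l: "l \<in> {1..h}" and eq: "\<theta> k = \<theta> l"
    have tykl: "ty k = ty l" using \<theta>_in(2)[OF k] \<theta>_in(2)[OF l] eq by simp
    have "\<tau> (ty k) (\<mu> k) = \<tau> (ty k) (\<mu> l)"
      using eq \<kappa>_inj[OF \<mu>(1)[OF k] \<tau>_in[OF \<mu>(1,2)[OF k]]] \<tau>_in[OF \<mu>(1,2)[OF l]] tykl
      unfolding \<theta>_def by simp
    then have "\<mu> k = \<mu> l"
      using permutes_inj[OF \<tau>[OF \<mu>(1)[OF k]]] by (simp add: inj_eq)
    then show "k = l" using \<mu>(3)[OF k] \<mu>(3)[OF l] tykl by metis
  qed
  then have \<theta>: "bij_betw \<theta> {1..h} {1..h}"
    using \<theta>_in(1) endo_inj_surj[of "{1..h}" \<theta>] unfolding bij_betw_def by blast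
  have "cone_iso (U k) (D k) (U (\<theta> k)) (D (\<theta> k)) (B (ty k) (\<mu> k))" if "k \<in> {1..h}" for k
    using B(1)[OF \<mu>(1,2)[OF that]] \<mu>(3)[OF that] unfolding \<theta>_def by simp
  from glue_part_isos[OF \<theta> this] obtain A where A: "cone_iso V C V C A"
    "\<And>k x. k \<in> {1..h} \<Longrightarrow> x \<in> U k \<Longrightarrow> A x = B (ty k) (\<mu> k) x"
    by blast
  show ?thesis
  proof (rule ProjI[OF \<sigma> A(1) C_subset])
    show "R ` {1..p} \<subseteq> extreme_rays C" using R_in by blast
    fix i' assume "i' \<in> {1..p}"
    then obtain x where "x \<in> S" "i' = \<beta> x" using bij_\<beta> unfolding bij_betw_def by blast
    then obtain j m i where x: "x = (j, m, i)" "j \<in> {1..q}" "m \<in> {1..n j}" "i \<in> X j" by blast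
    note jm = x(2,3)
    have gi: "g j m i \<in> X j"
      using permutes_in_image[OF Proj_permutes[OF g[OF jm]]] x(4) by simp
    have "\<phi> j m ` R i \<subseteq> U (\<kappa> j m)" using \<phi>_ray[OF x(2-4)] extreme_rays_part by blast
    then have "A y = B j m y" if "y \<in> \<phi> j m ` R i" for y
      using A(2)[of "\<kappa> j m" y] \<kappa>_in[OF jm] \<mu>_\<kappa>[OF jm] subsetD[OF _ that] by simp
    then have "A ` \<phi> j m ` R i = B j m ` \<phi> j m ` R i" by (rule image_cong[OF refl])
    then have "A ` R i' = \<phi> j (\<tau> j m) ` R (g j m i)"
      using B(2)[OF x(2-4)] \<beta>(1)[OF x(2-4)] \<open>i' = \<beta> x\<close> x(1) by simp
    also have "\<dots> = R (\<beta> (j, \<tau> j m, g j m i))"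
      using \<beta>(1)[OF jm(1) \<tau>_in[OF jm] gi] by simp
    also have "\<dots> = R (\<sigma> i')"
      using conj[OF \<open>x \<in> S\<close>] \<pi>_eq[OF x(2-4)] \<open>i' = \<beta> x\<close> x(1) by simp
    finally show "A ` R i' = R (\<sigma> i')" .
  qed
qed

lemma Proj_iso_product_of_wreath_products:
  "perm_group_iso \<beta> S
    (perm_direct_product {1..q} (\<lambda>j. {1..n j} \<times> X j)
      (\<lambda>j. wreath_product (X j) (Proj (U (rep j)) (D (rep j)) (X j) R) {1..n j} (Sym (n j))))
    {1..p} (Proj V C {1..p} R)" (is "perm_group_iso \<beta> S ?G _ _")
proof -
  have "Proj V C {1..p} R = {\<sigma>. \<sigma> permutes {1..p} \<and> (\<exists>\<pi>\<in>?G. \<forall>x\<in>S. \<sigma> (\<beta> x) = \<beta> (\<pi> x))}"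
  proof (intro equalityI subsetI CollectI conjI)
    fix \<sigma> assume \<sigma>: "\<sigma> \<in> Proj V C {1..p} R"
    show "\<sigma> permutes {1..p}" using Proj_permutes[OF \<sigma>] .
    show "\<exists>\<pi>\<in>?G. \<forall>x\<in>S. \<sigma> (\<beta> x) = \<beta> (\<pi> x)"
      by (rule Proj_imp_product_of_wreath_products[OF \<sigma>])
  next
    fix \<sigma> assume "\<sigma> \<in> {\<sigma>. \<sigma> permutes {1..p} \<and> (\<exists>\<pi>\<in>?G. \<forall>x\<in>S. \<sigma> (\<beta> x) = \<beta> (\<pi> x))}"
    then obtain \<pi> where "\<sigma> permutes {1..p}" "\<pi> \<in> ?G" "\<forall>x\<in>S. \<sigma> (\<beta> x) = \<beta> (\<pi> x)" by blast
    then show "\<sigma> \<in> Proj V C {1..p} R"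
      using product_of_wreath_products_imp_Proj by blast
  qed
  then show ?thesis using bij_\<beta> unfolding perm_group_iso_def by blast
qed

end

text \<open>Equality as permutation groups is read as transport along a bijection
  \<open>\<beta>\<close> that respects the geometric identification of rays. It is asserted for
  every admissible choice of \<open>\<kappa>\<close> and \<open>\<phi>\<close>, and the first
  conjunct ensures that such choices exist.\<close>

theorem theorem6:
  fixes V C :: "'a::real_vector set"
    and R U :: "nat \<Rightarrow> 'a set"
    and p h q :: nat
    and ty n rep :: "nat \<Rightarrow> nat"
  assumes "subspace V"
    and "polyhedral_cone V C"
    and "full_dimensional V C"
    and "pointed C"
    and "bij_betw R {1..p} (extreme_rays C)"
    and "nondecomposable_parts V C {1..h} U"
    and "proj_types C h U q ty n rep"
  shows "(\<exists>\<kappa> \<phi>. identification C h U q ty n rep \<kappa> \<phi>) \<and>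
    (\<forall>\<kappa> \<phi>. identification C h U q ty n rep \<kappa> \<phi> \<longrightarrow>
      (\<exists>\<beta>.
        (\<forall>j\<in>{1..q}. \<forall>m\<in>{1..n j}. \<forall>i\<in>ray_labels p R (U (rep j)).
           R (\<beta> (j, m, i)) = \<phi> j m ` R i) \<and>
        perm_group_iso \<beta>
          (SIGMA j:{1..q}. {1..n j} \<times> ray_labels p R (U (rep j)))
          (perm_direct_product {1..q}
             (\<lambda>j. {1..n j} \<times> ray_labels p R (U (rep j)))
             (\<lambda>j. wreath_product
                (ray_labels p R (U (rep j)))
                (Proj (U (rep j)) (part_cone C (U (rep j))) (ray_labels p R (U (rep j))) R)
                {1..n j} (Sym (n j))))
          {1..p} (Proj V C {1..p} R)))"
proof (intro conjI allI impI)
  show "\<exists>\<kappa> \<phi>. identification C h U q ty n rep \<kappa> \<phi>"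
    using identification_exists[OF assms(7)] .
  fix \<kappa> \<phi> assume ident: "identification C h U q ty n rep \<kappa> \<phi>"
  have "direct_sum V {1..h} U" using assms(6) unfolding nondecomposable_parts_def by blast
  from direct_sum_projections[OF this assms(1) finite_atLeastAtMost] obtain P where P:
    "\<forall>k\<in>{1..h}. linear (P k)"
    "\<forall>k\<in>{1..h}. \<forall>x\<in>V. P k x \<in> U k"
    "\<forall>x\<in>V. (\<Sum>k\<in>{1..h}. P k x) = x"
    "\<forall>k\<in>{1..h}. \<forall>l\<in>{1..h}. \<forall>u\<in>U l. P k u = (if k = l then u else 0)"
    "\<forall>k\<in>{1..h}. U k \<subseteq> V"
    by (elim exE conjE)
  interpret identified_cone_parts V C h U P R p q ty n rep \<kappa> \<phi>
  proof (intro identified_cone_parts.intro cone_parts.intro identified_cone_parts_axioms.intro)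
    show "C = convex_cone hull \<Union>(extreme_rays C)"
      using polyhedral_cone_generated_by_extreme_rays[OF assms(1,2,4)] .
    show "span C = V" using assms(3) unfolding full_dimensional_def .
  qed (use assms ident P in simp_all)
  show "\<exists>\<beta>. (\<forall>j\<in>{1..q}. \<forall>m\<in>{1..n j}. \<forall>i\<in>ray_labels p R (U (rep j)).
           R (\<beta> (j, m, i)) = \<phi> j m ` R i) \<and>
        perm_group_iso \<beta>
          (SIGMA j:{1..q}. {1..n j} \<times> ray_labels p R (U (rep j)))
          (perm_direct_product {1..q}
             (\<lambda>j. {1..n j} \<times> ray_labels p R (U (rep j)))
             (\<lambda>j. wreath_product
                (ray_labels p R (U (rep j)))
                (Proj (U (rep j)) (part_cone C (U (rep j))) (ray_labels p R (U (rep j))) R)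
                {1..n j} (Sym (n j))))
          {1..p} (Proj V C {1..p} R)"
    using \<beta>(1) Proj_iso_product_of_wreath_products by blast
qed

end
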